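(* Assume (A1)–(A4) hold and that $\operatorname{dom} h$ has finite diameter $D_h\ge 0$. Then, for any $\lambda>0$, $\theta>0$, integer $K\ge 1$ and $R>0$, SCPB1 with input $(\lambda,\theta,K)$ and constant $R$ satisfies: (a) for every cycle index $k$, the number of iterations within the $k$-th cycle $\mathcal{C}_k$ is bounded by $$\left\lceil (\theta K+1)\,\ln_0^+\!\left(\frac{\lambda k}{R}\right)\right\rceil+1;$$ (b) $$\mathbb{E}[\phi(\hat y_K^a)]-\phi_*\le \frac1K\left(\frac{D_h^2}{\lambda}+\frac{6R\min\{\lambda\bar M^2,\bar M D_h\}}{\lambda}+\frac{2\lambda\bar M^2}{\theta}\right).$$
   Context: Problem. $\xi$ is a random vector with support $\Xi$. Consider $\phi_*:=\min\{\phi(x):=f(x)+h(x): x\in\mathbb{R}^n\}$ with $f(x)=\mathbb{E}_\xi[F(x,\xi)]$. Here $\mathbb{R}^n$ has its Euclidean inner product $\langle\cdot,\cdot\rangle$ and norm $\|\cdot\|$. Assumptions. (A1) $f$ and $h$ are proper closed convex functions from $\mathbb{R}^n$ to $\mathbb{R}\cup\{+\infty\}$ with $\operatorname{dom} f\supset\operatorname{dom} h$. (A2) For almost every $\xi\in\Xi$ there are available a functional oracle $F(\cdot,\xi):\operatorname{dom} h\to\mathbb{R}$ and a stochastic subgradient oracle $s(\cdot,\xi):\operatorname{dom} h\to\mathbb{R}^n$ such that $f(x)=\mathbb{E}[F(x,\xi)]$ and $f'(x):=\mathbb{E}[s(x,\xi)]\in\partial f(x)$ for every $x\in\operatorname{dom}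 h$ ($F(\cdot,\xi)$ need not be convex). (A3) $\bar M:=\sup\{\mathbb{E}[\|s(x,\xi)\|^2]^{1/2}:x\in\operatorname{dom} h\}<\infty$. (A4) The set $X^*$ of optimal solutions is nonempty. SCPB scheme. Input: $\lambda,\theta>0$, integer $K\ge1$, $x_0\in\operatorname{dom} h$. Let $\tau=\theta K/(\theta K+1)$, $j_0=0$, and let $\xi_0,\xi_1,\dots$ be independent samples of $\xi$ (iteration $j$ draws $\xi_{j-1}$, independent of $\xi_0,\dots,\xi_{j-2}$). Iterations $j=1,2,\dots$ are grouped into $K$ consecutive cycles $\mathcal{C}_k=\{i_k,\dots,j_k\}$, $k=1,\dots,K$, where $i_k:=j_{k-1}+1$ and the integer $j_k\ge i_k$ is given by a cycle rule. For $j\in\mathcal{C}_k$: the prox-center is $x_j^c=x_{j_{k-1}}$; $S_j=s(x_{j_{k-1}},\xi_{j_{k-1}})$ if $j=i_k$ and $S_j=(1-\tau)s(x_{j-1},\xi_{j-1})+\tau S_{j-1}$ otherwise; $$x_j=\operatorname{argmin}_{u\in\mathbb{R}^n}\Big\{h(u)+\langle S_j,u\rangle+\tfrac1{2\lambda}\|u-x_j^c\|^2\Big\};$$ $y_j=x_j$ if $j=i_k$ and $y_j=(1-\tau)x_j+\tau y_{j-1}$ otherwise. Set $\hat y_k=y_{j_k}$. The output is $\hat y_K^a=\frac1{\lceil K/2\rceil}\sum_{k=\lfloor K/2\rfloor+1}^K\hat y_k$. SCPB1 (with constant $R>0$) is the SCPB scheme with the cycle rule: for every $k\ge1$, $j_k$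 is the smallest integer $\ge i_k$ such that $\lambda k\,\tau^{j_k-i_k}\le R$. Notation: $\ln_0^+(\cdot)=\max\{0,\ln(\cdot)\}$. *)

theory Defs
  imports "HOL-Probability.Probability"
begin

definition eff_dom :: "('a \<Rightarrow> ereal) \<Rightarrow> 'a set" where
  "eff_dom g = {x. g x < \<infinity>}"

definition epi :: "('a \<Rightarrow> ereal) \<Rightarrow> ('a \<times> real) set" where
  "epi g = {(x, r). g x \<le> ereal r}"

definition proper_closed_convex :: "('a::euclidean_space \<Rightarrow> ereal) \<Rightarrow> bool" where
  "proper_closed_convex g \<longleftrightarrow>
     (\<forall>x. g x \<noteq> -\<infinity>) \<and> eff_dom g \<noteq> {} \<and> closed (epi g) \<and> convex (epi g)"

definition subdifferential :: "('a::real_inner \<Rightarrow> ereal) \<Rightarrow> 'a \<Rightarrow> 'a set" where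
  "subdifferential g x = {v. \<forall>u. g x + ereal (v \<bullet> (u - x)) \<le> g u}"

definition optimal_value :: "('a \<Rightarrow> ereal) \<Rightarrow> ereal" where
  "optimal_value \<phi> = (INF x. \<phi> x)"

definition optimal_solutions :: "('a \<Rightarrow> ereal) \<Rightarrow> 'a set" where
  "optimal_solutions \<phi> = {x. \<phi> x = optimal_value \<phi>}"

text \<open>
  In the next three definitions \<open>D\<close> is the law of the random vector and \<open>X\<close> plays the role of
  the effective domain of \<open>h\<close>. The oracles are total functions of which only the values on \<open>X\<close>
  matter; an oracle available only for almost every sample is extended by a constant off a
  measurable set of full measure. The joint measurability of \<open>s\<close> makes the iterates of the
  scheme random variables.
\<close>

definition functional_oracle ::
  "'e measure \<Rightarrow> 'a set \<Rightarrow> ('a \<Rightarrow> ereal) \<Rightarrow> ('a \<Rightarrow> 'e \<Rightarrow> real) \<Rightarrow> bool" where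
  "functional_oracle D X f F \<longleftrightarrow>
     (\<forall>x\<in>X. integrable D (F x) \<and> f x = ereal (\<integral>z. F x z \<partial>D))"

definition subgradient_oracle ::
  "'e measure \<Rightarrow> 'a set \<Rightarrow> ('a \<Rightarrow> ereal) \<Rightarrow> ('a::euclidean_space \<Rightarrow> 'e \<Rightarrow> 'a) \<Rightarrow> bool" where
  "subgradient_oracle D X f s \<longleftrightarrow>
     (\<lambda>(x, z). s x z) \<in> borel_measurable (restrict_space borel X \<Otimes>\<^sub>M D) \<and>
     (\<forall>x\<in>X. integrable D (s x) \<and> (\<integral>z. s x z \<partial>D) \<in> subdifferential f x)"

text \<open>
  \<open>finite_second_moment\<close> says that the supremum \<open>second_moment_bound\<close>, taken in the
  extended reals, is finite.
\<close>

definition finite_second_moment ::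
  "'e measure \<Rightarrow> 'a set \<Rightarrow> ('a::euclidean_space \<Rightarrow> 'e \<Rightarrow> 'a) \<Rightarrow> bool" where
  "finite_second_moment D X s \<longleftrightarrow>
     (\<forall>x\<in>X. integrable D (\<lambda>z. (norm (s x z))\<^sup>2)) \<and>
     bdd_above ((\<lambda>x. sqrt (\<integral>z. (norm (s x z))\<^sup>2 \<partial>D)) ` X)"

definition second_moment_bound ::
  "'e measure \<Rightarrow> 'a set \<Rightarrow> ('a::euclidean_space \<Rightarrow> 'e \<Rightarrow> 'a) \<Rightarrow> real" where
  "second_moment_bound D X s = (SUP x\<in>X. sqrt (\<integral>z. (norm (s x z))\<^sup>2 \<partial>D))"

definition scpb_tau :: "real \<Rightarrow> nat \<Rightarrow> real" where
  "scpb_tau \<theta> K = \<theta> * real K / (\<theta> * real K + 1)"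

text \<open>A sequence \<open>e\<close> lists the last indices of the cycles, with \<open>e 0 = 0\<close>.\<close>

definition cycle_start :: "(nat \<Rightarrow> nat) \<Rightarrow> nat \<Rightarrow> nat" where
  "cycle_start e k = e (k - 1) + 1"

definition cycle :: "(nat \<Rightarrow> nat) \<Rightarrow> nat \<Rightarrow> nat set" where
  "cycle e k = {cycle_start e k..e k}"

definition cycle_ends :: "nat \<Rightarrow> (nat \<Rightarrow> nat) \<Rightarrow> bool" where
  "cycle_ends K e \<longleftrightarrow> e 0 = 0 \<and> (\<forall>k\<in>{1..K}. cycle_start e k \<le> e k)"

definition scpb1_rule :: "real \<Rightarrow> real \<Rightarrow> nat \<Rightarrow> real \<Rightarrow> (nat \<Rightarrow> nat) \<Rightarrow> bool" where
  "scpb1_rule lam \<theta> K R e \<longleftrightarrow>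
     (\<forall>k\<in>{1..K}. e k = (LEAST j. cycle_start e k \<le> j \<and>
        lam * real k * scpb_tau \<theta> K ^ (j - cycle_start e k) \<le> R))"

text \<open>
  One realization of the scheme, for the realization \<open>\<xi>\<close> of the sample sequence. In the \<open>k\<close>-th
  cycle the prox-center is \<open>x (e (k - 1))\<close>.
\<close>

definition scpb_run ::
  "('a::euclidean_space \<Rightarrow> ereal) \<Rightarrow> ('a \<Rightarrow> 'e \<Rightarrow> 'a) \<Rightarrow> real \<Rightarrow> real \<Rightarrow> nat \<Rightarrow> 'a \<Rightarrow>
    (nat \<Rightarrow> nat) \<Rightarrow> (nat \<Rightarrow> 'e) \<Rightarrow> (nat \<Rightarrow> 'a) \<Rightarrow> (nat \<Rightarrow> 'a) \<Rightarrow> (nat \<Rightarrow> 'a) \<Rightarrow> bool" where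
  "scpb_run h s lam \<theta> K x0 e \<xi> S x y \<longleftrightarrow>
     cycle_ends K e \<and> x 0 = x0 \<and>
     (let \<tau> = scpb_tau \<theta> K in
      \<forall>k\<in>{1..K}. \<forall>j\<in>cycle e k.
        S j = (if j = cycle_start e k then s (x (e (k - 1))) (\<xi> (e (k - 1)))
               else (1 - \<tau>) *\<^sub>R s (x (j - 1)) (\<xi> (j - 1)) + \<tau> *\<^sub>R S (j - 1)) \<and>
        is_arg_min
          (\<lambda>u. h u + ereal (S j \<bullet> u + 1 / (2 * lam) * (norm (u - x (e (k - 1))))\<^sup>2))
          (\<lambda>u. True) (x j) \<and>
        y j = (if j = cycle_start e k then x j
               else (1 - \<tau>) *\<^sub>R x j + \<tau> *\<^sub>R y (j - 1)))"

definition scpb1_run ::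
  "('a::euclidean_space \<Rightarrow> ereal) \<Rightarrow> ('a \<Rightarrow> 'e \<Rightarrow> 'a) \<Rightarrow> real \<Rightarrow> real \<Rightarrow> nat \<Rightarrow> real \<Rightarrow> 'a \<Rightarrow>
    (nat \<Rightarrow> nat) \<Rightarrow> (nat \<Rightarrow> 'e) \<Rightarrow> (nat \<Rightarrow> 'a) \<Rightarrow> (nat \<Rightarrow> 'a) \<Rightarrow> (nat \<Rightarrow> 'a) \<Rightarrow> bool" where
  "scpb1_run h s lam \<theta> K R x0 e \<xi> S x y \<longleftrightarrow>
     scpb_run h s lam \<theta> K x0 e \<xi> S x y \<and> scpb1_rule lam \<theta> K R e"

definition scpb_output :: "nat \<Rightarrow> (nat \<Rightarrow> nat) \<Rightarrow> (nat \<Rightarrow> 'a::real_vector) \<Rightarrow> 'a" where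
  "scpb_output K e y =
     (1 / real_of_int \<lceil>real K / 2\<rceil>) *\<^sub>R (\<Sum>k = K div 2 + 1..K. y (e k))"

definition ln_0_plus :: "real \<Rightarrow> real" where
  "ln_0_plus t = max 0 (ln t)"

end

theory Submission
  imports Defs
begin

text \<open>
  Within a cycle the aggregated linearizations of \<open>f\<close> form an affine model that lies below \<open>f\<close> in
  expectation, because each sample is independent of the point at which it is used. Strong convexity
  of the proximal model gives \<open>\<phi> (y j) - \<phi> u \<le> (\<parallel>u - c\<parallel>\<^sup>2 - \<parallel>u - x j\<parallel>\<^sup>2) / (2 \<lambda>) + gap + noise\<close>
  with \<open>c\<close> the prox-center, and the gap between \<open>\<phi> (y j)\<close> and the optimal value of the model
  contracts by \<open>\<tau>\<close> in each iteration up to an error \<open>2 \<lambda> M\<^sup>2 (1 - \<tau>)\<^sup>2 / \<tau>\<close>. Since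
  \<open>(1 - \<tau>) / \<tau> = 1 / (\<theta> K)\<close>, the accumulated error per cycle is \<open>2 \<lambda> M\<^sup>2 / (\<theta> K)\<close>, and the cycle rule makes
  the remaining initial gap \<open>O(1 / k)\<close>. Summing over the last half of the cycles telescopes the
  squared distances. The models use \<open>f\<close> itself instead of the sampled values \<open>F\<close>, which changes
  neither the iterates nor the expectations. As \<open>h\<close> may be unbounded on its domain, integrability of
  \<open>\<phi>\<close> at the output is obtained by sandwiching it between the optimal value and the integrable
  pathwise upper bound.
\<close>

section \<open>Closed convex functions and proximal steps\<close>

lemma ereal_real_of_eff_dom:
  assumes "proper_closed_convex g" "x \<in> eff_dom g"
  shows "ereal (real_of_ereal (g x)) = g x"
  using assms by (cases "g x") (auto simp: proper_closed_convex_def eff_dom_def)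

text \<open>Two points of the graph lie in the convex epigraph, and so does the segment between
  them. Passing to real values on the effective domain makes the library facts on
  \<open>convex_on\<close> available.\<close>

lemma proper_closed_convex_convex_on:
  assumes g: "proper_closed_convex g"
  shows "convex_on (eff_dom g) (\<lambda>x. real_of_ereal (g x))"
proof -
  have *: "g ((1 - t) *\<^sub>R x + t *\<^sub>R y)
      \<le> ereal ((1 - t) * real_of_ereal (g x) + t * real_of_ereal (g y))"
    if "x \<in> eff_dom g" "y \<in> eff_dom g" "0 \<le> t" "t \<le> 1" for x y t
  proof -
    have "(x, real_of_ereal (g x)) \<in> epi g" "(y, real_of_ereal (g y)) \<in> epi g"
      using that by (simp_all add: epi_def ereal_real_of_eff_dom[OF g])
    moreover have "convex (epi g)"
      using g by (simp add: proper_closed_convex_def)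
    ultimately have "(1 - t) *\<^sub>R (x, real_of_ereal (g x)) + t *\<^sub>R (y, real_of_ereal (g y)) \<in> epi g"
      using that by (intro convexD) auto
    then show ?thesis
      by (simp add: epi_def)
  qed
  have dom: "convex (eff_dom g)"
    unfolding convex_alt
  proof (intro ballI allI impI)
    fix x y and t :: real
    assume "x \<in> eff_dom g" "y \<in> eff_dom g" "0 \<le> t \<and> t \<le> 1"
    then have "g ((1 - t) *\<^sub>R x + t *\<^sub>R y)
        \<le> ereal ((1 - t) * real_of_ereal (g x) + t * real_of_ereal (g y))"
      by (intro *) auto
    also have "\<dots> < \<infinity>"
      by simp
    finally show "(1 - t) *\<^sub>R x + t *\<^sub>R y \<in> eff_dom g"
      by (simp add: eff_dom_def)
  qed
  show ?thesis
  proof (rule convex_onI[OF _ dom])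
    fix t :: real and x y
    assume a: "0 < t" "t < 1" "x \<in> eff_dom g" "y \<in> eff_dom g"
    then have w: "(1 - t) *\<^sub>R x + t *\<^sub>R y \<in> eff_dom g"
      using dom by (intro convexD) auto
    have "ereal (real_of_ereal (g ((1 - t) *\<^sub>R x + t *\<^sub>R y)))
        \<le> ereal ((1 - t) * real_of_ereal (g x) + t * real_of_ereal (g y))"
      unfolding ereal_real_of_eff_dom[OF g w] using *[of x y t] a by simp
    then show "real_of_ereal (g ((1 - t) *\<^sub>R x + t *\<^sub>R y))
        \<le> (1 - t) * real_of_ereal (g x) + t * real_of_ereal (g y)"
      by simp
  qed
qed

text \<open>The sublevel set at a real level \<open>r\<close> is the preimage of the closed epigraph
  under the continuous map sending \<open>x\<close> to \<open>(x, r)\<close>, hence closed.\<close>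

lemma proper_closed_convex_borel_measurable:
  fixes g :: "'a::euclidean_space \<Rightarrow> ereal"
  assumes "proper_closed_convex g"
  shows "g \<in> borel_measurable borel"
proof -
  have "{x. g x \<le> ereal r} \<in> sets borel" for r
  proof -
    have "closed ((\<lambda>x. (x, r)) -` epi g)"
      using assms by (intro continuous_closed_vimage) (auto simp: proper_closed_convex_def)
    then show ?thesis
      by (simp add: epi_def vimage_def)
  qed
  moreover have "{x. g x \<le> -\<infinity>} = {}"
    using assms by (auto simp: proper_closed_convex_def)
  moreover have "{x. g x \<le> \<infinity>} = UNIV"
    by auto
  ultimately have "{x. g x \<le> a} \<in> sets borel" for a
    by (cases a) (simp_all del: ereal_less_eq ereal_infty_less_eq2 ereal_infty_less_eq)
  then show ?thesis
    by (subst borel_measurable_iff_Iic_ereal) (simp add: vimage_def)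
qed

text \<open>The objective is written exactly as in \<open>scpb_run\<close>, so that facts about a
  run are instances of this predicate, with slope \<open>a\<close> and prox-center
  \<open>c\<close>.\<close>

definition prox_step :: "('a::euclidean_space \<Rightarrow> ereal) \<Rightarrow> real \<Rightarrow> 'a \<Rightarrow> 'a \<Rightarrow> 'a \<Rightarrow> bool" where
  "prox_step h lam a c x \<longleftrightarrow> is_arg_min
     (\<lambda>u. h u + ereal (a \<bullet> u + 1 / (2 * lam) * (norm (u - c))\<^sup>2)) (\<lambda>u. True) x"

lemma prox_step_eff_dom:
  assumes h: "proper_closed_convex h" and x: "prox_step h lam a c x"
  shows "x \<in> eff_dom h"
proof -
  obtain u where u: "u \<in> eff_dom h"
    using h by (auto simp: proper_closed_convex_def)
  have "h x + ereal (a \<bullet> x + 1 / (2 * lam) * (norm (x - c))\<^sup>2)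
      \<le> h u + ereal (a \<bullet> u + 1 / (2 * lam) * (norm (u - c))\<^sup>2)"
    using x by (simp add: prox_step_def is_arg_min_linorder)
  then show ?thesis
    using u by (auto simp: eff_dom_def)
qed

lemma prox_step_le:
  assumes h: "proper_closed_convex h" and x: "prox_step h lam a c x" and u: "u \<in> eff_dom h"
  shows "real_of_ereal (h x) + a \<bullet> x + (norm (x - c))\<^sup>2 / (2 * lam)
      \<le> real_of_ereal (h u) + a \<bullet> u + (norm (u - c))\<^sup>2 / (2 * lam)"
proof -
  have "ereal (real_of_ereal (h x)) + ereal (a \<bullet> x + 1 / (2 * lam) * (norm (x - c))\<^sup>2)
      \<le> ereal (real_of_ereal (h u)) + ereal (a \<bullet> u + 1 / (2 * lam) * (norm (u - c))\<^sup>2)"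
    unfolding ereal_real_of_eff_dom[OF h u] ereal_real_of_eff_dom[OF h prox_step_eff_dom[OF h x]]
    using x by (simp add: prox_step_def is_arg_min_linorder)
  then show ?thesis
    by simp
qed

lemma norm_convex_combination_square:
  fixes a b :: "'a::real_inner"
  shows "(norm ((1 - t) *\<^sub>R a + t *\<^sub>R b))\<^sup>2
    = (1 - t) * (norm a)\<^sup>2 + t * (norm b)\<^sup>2 - t * (1 - t) * (norm (b - a))\<^sup>2"
  unfolding power2_norm_eq_inner
  by (simp add: inner_add_left inner_add_right inner_diff_left inner_diff_right
      inner_commute[of b a] algebra_simps)

text \<open>The quadratic term makes the objective strongly convex. Minimality is tested at a point
  \<open>w\<close> of the segment from \<open>x\<close> to \<open>u\<close>; dividing by the weight
  \<open>t\<close> of \<open>u\<close> leaves the factor \<open>1 - t\<close> on the extra square,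
  and \<open>t\<close> then tends to 0.\<close>

lemma prox_step_strong:
  assumes h: "proper_closed_convex h" and lam: "lam > 0"
    and x: "prox_step h lam a c x" and u: "u \<in> eff_dom h"
  shows "real_of_ereal (h x) + a \<bullet> x + (norm (x - c))\<^sup>2 / (2 * lam) + (norm (u - x))\<^sup>2 / (2 * lam)
      \<le> real_of_ereal (h u) + a \<bullet> u + (norm (u - c))\<^sup>2 / (2 * lam)"
proof -
  define H where "H = (\<lambda>x. real_of_ereal (h x))"
  define q where "q = (\<lambda>u v :: 'a. (norm (u - v))\<^sup>2 / (2 * lam))"
  define g where "g = (\<lambda>u. H u + a \<bullet> u + q u c)"
  have H: "convex_on (eff_dom h) H"
    unfolding H_def by (rule proper_closed_convex_convex_on[OF h])
  have xd: "x \<in> eff_dom h"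
    by (rule prox_step_eff_dom[OF h x])
  have *: "g x + (1 - t) * q u x \<le> g u" if t: "0 < t" "t < 1" for t
  proof -
    define w where "w = (1 - t) *\<^sub>R x + t *\<^sub>R u"
    have w: "w \<in> eff_dom h"
      using t H xd u unfolding w_def by (intro convexD) (auto simp: convex_on_def)
    have 1: "H w \<le> (1 - t) * H x + t * H u"
      unfolding w_def using t H xd u by (intro convex_onD) auto
    have "w - c = (1 - t) *\<^sub>R (x - c) + t *\<^sub>R (u - c)"
      by (simp add: w_def algebra_simps)
    then have "(norm (w - c))\<^sup>2
        = (1 - t) * (norm (x - c))\<^sup>2 + t * (norm (u - c))\<^sup>2 - t * (1 - t) * (norm (u - x))\<^sup>2"
      using norm_convex_combination_square[of t "x - c" "u - c"] by simp
    then have 2: "q w c = (1 - t) * q x c + t * q u c - t * (1 - t) * q u x"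
      by (simp only: q_def add_divide_distrib diff_divide_distrib times_divide_eq_right)
    have 3: "a \<bullet> w = (1 - t) * (a \<bullet> x) + t * (a \<bullet> u)"
      by (simp add: w_def inner_add_right)
    have "g x \<le> g w"
      unfolding g_def H_def q_def by (rule prox_step_le[OF h x w])
    also have "g w \<le> (1 - t) * g x + t * g u - t * ((1 - t) * q u x)"
      using 1 by (simp add: g_def 2 3 algebra_simps)
    finally have "t * (g x + (1 - t) * q u x) \<le> t * g u"
      by (simp add: algebra_simps)
    then show ?thesis
      using t by simp
  qed
  have "((\<lambda>t. g x + (1 - t) * q u x)
      \<longlongrightarrow> g x + (1 - 0) * q u x) (at_right 0)"
    by (intro tendsto_intros)
  moreover have "\<forall>\<^sub>F t in at_right (0::real).
      g x + (1 - t) * q u x \<le> g u"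
    using * eventually_at_right[of 0 "1::real"] by (auto intro: exI[of _ 1])
  ultimately have "g x + (1 - 0) * q u x \<le> g u"
    by (intro tendsto_upperbound) auto
  then show ?thesis
    by (simp add: g_def H_def q_def)
qed

text \<open>The minimizer is the proximal point of \<open>lam\<close> times \<open>h\<close> at
  \<open>c - lam *\<^sub>R a\<close>; adding the strong inequalities of the two problems, each
  tested at the other minimizer, gives nonexpansiveness. It serves to prove that the iterates, known
  only as minimizers, are measurable.\<close>

lemma prox_step_nonexpansive:
  assumes h: "proper_closed_convex h" and lam: "lam > 0"
    and x: "prox_step h lam a c x" and x': "prox_step h lam a' c' x'"
  shows "norm (x - x') \<le> norm ((c - lam *\<^sub>R a) - (c' - lam *\<^sub>R a'))"
proof -
  define q where "q = (\<lambda>u v :: 'a. (norm (u - v))\<^sup>2 / (2 * lam))"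
  have q: "2 * lam * q u v = (norm (u - v))\<^sup>2" for u v
    using lam by (simp add: q_def)
  have "a \<bullet> x + q x c + q x' x + a' \<bullet> x' + q x' c' + q x x' \<le> a \<bullet> x' + q x' c + a' \<bullet> x + q x c'"
    using prox_step_strong[OF h lam x prox_step_eff_dom[OF h x']]
      prox_step_strong[OF h lam x' prox_step_eff_dom[OF h x]]
    unfolding q_def by linarith
  then have "2 * lam * (a \<bullet> x + q x c + q x' x + a' \<bullet> x' + q x' c' + q x x')
      \<le> 2 * lam * (a \<bullet> x' + q x' c + a' \<bullet> x + q x c')"
    using lam by (intro mult_left_mono) auto
  then have "2 * lam * (a \<bullet> x + a' \<bullet> x') + (norm (x - c))\<^sup>2 + (norm (x' - c'))\<^sup>2
        + (norm (x' - x))\<^sup>2 + (norm (x - x'))\<^sup>2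
      \<le> 2 * lam * (a \<bullet> x' + a' \<bullet> x) + (norm (x' - c))\<^sup>2 + (norm (x - c'))\<^sup>2"
    unfolding distrib_left q by linarith
  moreover have "(norm (x' - c))\<^sup>2 + (norm (x - c'))\<^sup>2 - (norm (x - c))\<^sup>2 - (norm (x' - c'))\<^sup>2
      = 2 * ((c - c') \<bullet> (x - x'))"
    unfolding power2_norm_eq_inner inner_diff_left inner_diff_right
    by (simp add: inner_commute)
  moreover have "2 * lam * (a \<bullet> x + a' \<bullet> x') - 2 * lam * (a \<bullet> x' + a' \<bullet> x)
      = 2 * (lam * ((a - a') \<bullet> (x - x')))"
    unfolding inner_diff_left inner_diff_right by (simp add: algebra_simps)
  ultimately have "(norm (x - x'))\<^sup>2 \<le> (c - c') \<bullet> (x - x') - lam * ((a - a') \<bullet> (x - x'))"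
    unfolding norm_minus_commute[of x' x] by linarith
  also have "\<dots> = ((c - lam *\<^sub>R a) - (c' - lam *\<^sub>R a')) \<bullet> (x - x')"
    unfolding inner_diff_left inner_scaleR_left by (simp add: right_diff_distrib)
  also have "\<dots> \<le> norm ((c - lam *\<^sub>R a) - (c' - lam *\<^sub>R a')) * norm (x - x')"
    by (rule norm_cauchy_schwarz)
  finally show ?thesis
    by (cases "x = x'") (auto simp: power2_eq_square)
qed

section \<open>Measurability and independence\<close>

text \<open>The hypothesis makes \<open>x\<close> a 1-Lipschitz function of \<open>w\<close>. The
  image of \<open>w\<close> may fail to be a Borel set, so the factor is treated on the restricted
  space over that image.\<close>

lemma borel_measurable_nonexpansive_image:
  fixes w :: "'w \<Rightarrow> 'a::euclidean_space" and x :: "'w \<Rightarrow> 'b::euclidean_space"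
  assumes w: "w \<in> borel_measurable M"
    and x: "\<And>\<omega> \<omega>'. \<omega> \<in> space M \<Longrightarrow> \<omega>' \<in> space M \<Longrightarrow> norm (x \<omega> - x \<omega>') \<le> norm (w \<omega> - w \<omega>')"
  shows "x \<in> borel_measurable M"
proof -
  \<comment> \<open>Any preimage of \<open>a\<close> may be chosen: points with equal
    \<open>w\<close> have equal \<open>x\<close>.\<close>
  define g where "g = (\<lambda>a. x (SOME \<omega>. \<omega> \<in> space M \<and> w \<omega> = a))"
  have g: "x \<omega> = g (w \<omega>)" if "\<omega> \<in> space M" for \<omega>
  proof -
    have "(SOME \<omega>'. \<omega>' \<in> space M \<and> w \<omega>' = w \<omega>) \<in> space M \<and> w (SOME \<omega>'. \<omega>' \<in> space M \<and> w \<omega>' = w \<omega>) = w \<omega>"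
      by (rule someI[where x = \<omega>]) (use that in simp)
    then show ?thesis
      using x[OF that, of "SOME \<omega>'. \<omega>' \<in> space M \<and> w \<omega>' = w \<omega>"] by (simp add: g_def)
  qed
  have "1-lipschitz_on (w ` space M) g"
    by (rule lipschitz_onI) (use x g in \<open>auto simp: dist_norm\<close>)
  then have "g \<in> borel_measurable (restrict_space borel (w ` space M))"
    by (intro borel_measurable_continuous_on_restrict lipschitz_on_continuous_on)
  moreover have "w \<in> M \<rightarrow>\<^sub>M restrict_space borel (w ` space M)"
    using w by (intro measurable_restrict_space2) auto
  ultimately have "(\<lambda>\<omega>. g (w \<omega>)) \<in> borel_measurable M"
    by (rule measurable_compose[rotated])
  then show ?thesis
    using g by (simp cong: measurable_cong)
qed

text \<open>Fubini replaces conditioning on \<open>Z\<close>: with the value of \<open>Z\<close>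
  frozen, the integral over the law of \<open>Y\<close> is estimated pointwise. The uniform bound
  \<open>C\<close> supplies the joint integrability that Fubini requires.\<close>

lemma (in prob_space) integral_product_law_le:
  fixes g :: "'b \<times> 'c \<Rightarrow> real"
  assumes rv [measurable]: "Z \<in> M \<rightarrow>\<^sub>M N" "Y \<in> M \<rightarrow>\<^sub>M L"
    and eq: "distr M N Z \<Otimes>\<^sub>M distr M L Y = distr M (N \<Otimes>\<^sub>M L) (\<lambda>\<omega>. (Z \<omega>, Y \<omega>))"
    and g: "g \<in> borel_measurable (N \<Otimes>\<^sub>M L)"
    and int: "\<And>z. z \<in> space N \<Longrightarrow> integrable (distr M L Y) (\<lambda>w. g (z, w))"
    and bound: "\<And>z. z \<in> space N \<Longrightarrow> (\<integral>w. \<bar>g (z, w)\<bar> \<partial>distr M L Y) \<le> C"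
    and le: "\<And>z. z \<in> space N \<Longrightarrow> (\<integral>w. g (z, w) \<partial>distr M L Y) \<le> c"
  shows "integrable M (\<lambda>\<omega>. g (Z \<omega>, Y \<omega>))" "expectation (\<lambda>\<omega>. g (Z \<omega>, Y \<omega>)) \<le> c"
proof -
  note g[measurable]
  interpret A: prob_space "distr M N Z" by (rule prob_space_distr) simp
  interpret B: prob_space "distr M L Y" by (rule prob_space_distr) simp
  interpret AB: pair_prob_space "distr M N Z" "distr M L Y" ..
  have gm [measurable]: "g \<in> borel_measurable (distr M N Z \<Otimes>\<^sub>M distr M L Y)"
    by simp
  have *: "integrable (distr M N Z \<Otimes>\<^sub>M distr M L Y) g"
  proof (rule AB.Fubini_integrable[OF gm])
    show "integrable (distr M N Z) (\<lambda>z. \<integral>w. norm (g (z, w)) \<partial>distr M L Y)"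
      using bound by (intro A.integrable_const_bound[where B = C]) auto
  qed (use int in auto)
  then show "integrable M (\<lambda>\<omega>. g (Z \<omega>, Y \<omega>))"
    unfolding eq by (subst (asm) integrable_distr_eq) auto
  have "expectation (\<lambda>\<omega>. g (Z \<omega>, Y \<omega>)) = integral\<^sup>L (distr M N Z \<Otimes>\<^sub>M distr M L Y) g"
    unfolding eq by (subst integral_distr) auto
  also have "\<dots> = (\<integral>z. (\<integral>w. g (z, w) \<partial>distr M L Y) \<partial>distr M N Z)"
    by (rule AB.integral_fst'[OF *, symmetric])
  also have "\<dots> \<le> c"
    using AB.integrable_fst'[OF *] le by (intro A.integral_le_const) auto
  finally show "expectation (\<lambda>\<omega>. g (Z \<omega>, Y \<omega>)) \<le> c" .
qed

lemma (in prob_space) expectation_square_le: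
  fixes X :: "'a \<Rightarrow> real"
  assumes "integrable M X" "integrable M (\<lambda>x. (X x)\<^sup>2)"
  shows "(expectation X)\<^sup>2 \<le> expectation (\<lambda>x. (X x)\<^sup>2)"
  using variance_eq[OF assms] variance_positive[of X] by simp

text \<open>The sigma-algebra generated by the samples with index below \<open>j\<close>;
  measurability with respect to it expresses that a quantity is determined before
  \<open>\<xi> j\<close> is drawn.\<close>

definition past :: "'w measure \<Rightarrow> (nat \<Rightarrow> 'w \<Rightarrow> 'e::topological_space) \<Rightarrow> nat \<Rightarrow> 'w measure" where
  "past M \<xi> j = vimage_algebra (space M) (\<lambda>\<omega>. restrict (\<lambda>i. \<xi> i \<omega>) {..<j}) (PiM {..<j} (\<lambda>_. borel))"

lemma space_past [simp]: "space (past M \<xi> j) = space M"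
  by (simp add: past_def)

lemma restrict_space_PiM: "(\<lambda>\<omega>. restrict (\<lambda>i. \<xi> i \<omega>) A) \<in> B \<rightarrow> space (PiM A (\<lambda>_. borel))"
  by (auto simp: space_PiM)

lemma measurable_past_component:
  assumes "i < j"
  shows "\<xi> i \<in> borel_measurable (past M \<xi> j)"
proof -
  have "(\<lambda>\<omega>. restrict (\<lambda>i. \<xi> i \<omega>) {..<j}) \<in> past M \<xi> j \<rightarrow>\<^sub>M PiM {..<j} (\<lambda>_. borel)"
    unfolding past_def by (rule measurable_vimage_algebra1[OF restrict_space_PiM])
  from measurable_compose[OF this measurable_component_singleton[of i]] show ?thesis
    using assms by simp
qed

lemma measurable_past_mono:
  assumes "i \<le> j" and Z: "Z \<in> past M \<xi> i \<rightarrow>\<^sub>M N"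
  shows "Z \<in> past M \<xi> j \<rightarrow>\<^sub>M N"
proof -
  have "(\<lambda>\<omega>. \<omega>) \<in> past M \<xi> j \<rightarrow>\<^sub>M past M \<xi> i"
    unfolding past_def[of M \<xi> i]
    by (rule measurable_vimage_algebra2)
      (use assms(1) in \<open>auto intro!: measurable_restrict measurable_past_component\<close>)
  from measurable_compose[OF this Z] show ?thesis .
qed

lemma measurable_past_measurable:
  assumes \<xi>: "\<And>i. \<xi> i \<in> borel_measurable M" and Z: "Z \<in> past M \<xi> j \<rightarrow>\<^sub>M N"
  shows "Z \<in> M \<rightarrow>\<^sub>M N"
proof -
  have "(\<lambda>\<omega>. \<omega>) \<in> M \<rightarrow>\<^sub>M past M \<xi> j"
    unfolding past_def
    by (rule measurable_vimage_algebra2) (auto intro!: measurable_restrict \<xi>)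
  from measurable_compose[OF this Z] show ?thesis .
qed

text \<open>The sample blocks \<open>{..<j}\<close> and \<open>{j}\<close> are independent, and
  preimages under \<open>Z\<close> belong to the sigma-algebra of the first block. Probabilities of
  rectangles therefore factor, which determines the joint law.\<close>

lemma (in prob_space) distr_past_pair:
  assumes ind: "indep_vars (\<lambda>_. borel) \<xi> UNIV" and Z: "Z \<in> past M \<xi> j \<rightarrow>\<^sub>M N"
  shows "distr M N Z \<Otimes>\<^sub>M distr M borel (\<xi> j) = distr M (N \<Otimes>\<^sub>M borel) (\<lambda>\<omega>. (Z \<omega>, \<xi> j \<omega>))"
proof -
  let ?r = "\<lambda>A \<omega>. restrict (\<lambda>i. \<xi> i \<omega>) A" and ?P = "\<lambda>A. PiM A (\<lambda>_. borel)"
  have \<xi> [measurable]: "\<xi> i \<in> borel_measurable M" for i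
    using ind by (auto simp: indep_vars_def)
  have Zm [measurable]: "Z \<in> M \<rightarrow>\<^sub>M N"
    by (rule measurable_past_measurable[OF \<xi> Z])
  have indep: "indep_set (sigma_sets (space M) {?r {..<j} -` A \<inter> space M | A. A \<in> sets (?P {..<j})})
      (sigma_sets (space M) {?r {j} -` A \<inter> space M | A. A \<in> sets (?P {j})})"
    using indep_var_restrict[OF ind, of "{..<j}" "{j}"] by (simp add: indep_var_eq)
  have past: "sets (past M \<xi> j) = {?r {..<j} -` A \<inter> space M | A. A \<in> sets (?P {..<j})}"
    unfolding past_def by (rule sets_vimage_algebra2[OF restrict_space_PiM])
  have prod: "prob ((Z -` A \<inter> space M) \<inter> (\<xi> j -` B \<inter> space M))
      = prob (Z -` A \<inter> space M) * prob (\<xi> j -` B \<inter> space M)"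
    if A: "A \<in> sets N" and B: "B \<in> sets borel" for A B
  proof (rule indep_setD[OF indep])
    show "Z -` A \<inter> space M \<in> sigma_sets (space M) {?r {..<j} -` A \<inter> space M | A. A \<in> sets (?P {..<j})}"
      using measurable_sets[OF Z A] by (intro sigma_sets.Basic) (simp flip: past)
    have "(\<lambda>v. v j) -` B \<inter> space (?P {j}) \<in> sets (?P {j})"
      using B by (intro measurable_sets[OF measurable_component_singleton]) auto
    moreover have "\<xi> j -` B \<inter> space M = ?r {j} -` ((\<lambda>v. v j) -` B \<inter> space (?P {j})) \<inter> space M"
      by (auto simp: space_PiM)
    ultimately show "\<xi> j -` B \<inter> space M
        \<in> sigma_sets (space M) {?r {j} -` A \<inter> space M | A. A \<in> sets (?P {j})}"
      by (intro sigma_sets.Basic) blast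
  qed
  interpret A: prob_space "distr M N Z" by (rule prob_space_distr) simp
  interpret B: prob_space "distr M borel (\<xi> j)" by (rule prob_space_distr) simp
  show ?thesis
  proof (rule pair_measure_eqI)
    fix A B assume AB: "A \<in> sets (distr M N Z)" "B \<in> sets (distr M borel (\<xi> j))"
    then have "(\<lambda>\<omega>. (Z \<omega>, \<xi> j \<omega>)) -` (A \<times> B) \<inter> space M
        = (Z -` A \<inter> space M) \<inter> (\<xi> j -` B \<inter> space M)"
      by auto
    then show "emeasure (distr M N Z) A * emeasure (distr M borel (\<xi> j)) B
        = emeasure (distr M (N \<Otimes>\<^sub>M borel) (\<lambda>\<omega>. (Z \<omega>, \<xi> j \<omega>))) (A \<times> B)"
      using AB prod[of A B] by (simp add: emeasure_distr emeasure_eq_measure ennreal_mult'')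
  qed (auto intro: A.sigma_finite_measure_axioms B.sigma_finite_measure_axioms)
qed

section \<open>Analysis of the scheme\<close>

lemma scpb_tau_bounds:
  assumes "\<theta> > 0" "K \<ge> 1"
  shows "0 < scpb_tau \<theta> K" "scpb_tau \<theta> K < 1"
    and "1 - scpb_tau \<theta> K = 1 / (\<theta> * real K + 1)"
    and "(1 - scpb_tau \<theta> K) / scpb_tau \<theta> K = 1 / (\<theta> * real K)"
proof -
  have "\<theta> * real K > 0"
    using assms by simp
  then show "0 < scpb_tau \<theta> K" "scpb_tau \<theta> K < 1" "1 - scpb_tau \<theta> K = 1 / (\<theta> * real K + 1)"
    "(1 - scpb_tau \<theta> K) / scpb_tau \<theta> K = 1 / (\<theta> * real K)"
    unfolding scpb_tau_def by (auto simp: divide_simps)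
qed

text \<open>From \<open>1 + t \<le> exp t\<close> the weight is at most
  \<open>exp (- 1 / (\<theta> * real K + 1))\<close>, so \<open>n\<close> factors push the exponent
  below \<open>- ln r\<close>.\<close>

lemma scpb_tau_power_le:
  assumes \<theta>: "\<theta> > 0" and K: "K \<ge> 1" and r: "r > 0"
    and n: "(\<theta> * real K + 1) * ln_0_plus r \<le> real n"
  shows "r * scpb_tau \<theta> K ^ n \<le> 1"
proof -
  let ?\<tau> = "scpb_tau \<theta> K" and ?q = "\<theta> * real K + 1"
  have q: "?q > 0"
    using \<theta> by (simp add: add_nonneg_pos)
  have \<tau>: "?\<tau> - 1 = - (1 / ?q)"
    using scpb_tau_bounds(3)[OF \<theta> K] by linarith
  have "?\<tau> ^ n \<le> exp (?\<tau> - 1) ^ n"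
    using exp_ge_add_one_self[of "?\<tau> - 1"] scpb_tau_bounds[OF \<theta> K] by (intro power_mono) auto
  also have "\<dots> = exp (- (real n / ?q))"
    unfolding \<tau> exp_of_nat_mult[symmetric] by simp
  also have "\<dots> \<le> exp (- ln_0_plus r)"
    using n q by (simp add: field_simps)
  also have "\<dots> \<le> exp (- ln r)"
    by (simp add: ln_0_plus_def)
  also have "\<dots> = 1 / r"
    using r by (simp add: exp_minus field_simps)
  finally show ?thesis
    using r by (simp add: field_simps)
qed

text \<open>The rounded-up logarithmic bound is an admissible offset from the cycle start. Hence the
  \<open>LEAST\<close> is attained and no larger than this; the added 1 counts the iteration at
  offset 0.\<close>

lemma scpb1_rule_least:
  assumes rule: "scpb1_rule lam \<theta> K R e" and \<theta>: "\<theta> > 0" and K: "K \<ge> 1"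
    and lam: "lam > 0" and R: "R > 0" and k: "k \<in> {1..K}"
  shows "lam * real k * scpb_tau \<theta> K ^ (e k - cycle_start e k) \<le> R"
    and "int (card (cycle e k)) \<le> \<lceil>(\<theta> * real K + 1) * ln_0_plus (lam * real k / R)\<rceil> + 1"
proof -
  define Q where "Q = (\<lambda>j. cycle_start e k \<le> j \<and>
        lam * real k * scpb_tau \<theta> K ^ (j - cycle_start e k) \<le> R)"
  define a where "a = (\<theta> * real K + 1) * ln_0_plus (lam * real k / R)"
  have "a \<ge> 0"
    using \<theta> by (simp add: a_def ln_0_plus_def)
  then have n: "int (nat \<lceil>a\<rceil>) = \<lceil>a\<rceil>"
    by simp
  have "lam * real k / R * scpb_tau \<theta> K ^ nat \<lceil>a\<rceil> \<le> 1"
    by (rule scpb_tau_power_le[OF \<theta> K]) (use k lam R in \<open>auto simp: real_nat_ceiling_ge simp flip: a_def\<close>)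
  then have Q: "Q (cycle_start e k + nat \<lceil>a\<rceil>)"
    using R by (simp add: Q_def field_simps)
  have e: "e k = (LEAST j. Q j)"
    using rule k by (simp add: scpb1_rule_def Q_def)
  have "Q (e k)"
    unfolding e by (rule LeastI[of Q, OF Q])
  then show "lam * real k * scpb_tau \<theta> K ^ (e k - cycle_start e k) \<le> R"
    by (simp add: Q_def)
  have "e k \<le> cycle_start e k + nat \<lceil>a\<rceil>"
    unfolding e by (rule Least_le[of Q, OF Q])
  then have "card (cycle e k) \<le> nat \<lceil>a\<rceil> + 1"
    by (simp add: cycle_def)
  then show "int (card (cycle e k)) \<le> \<lceil>(\<theta> * real K + 1) * ln_0_plus (lam * real k / R)\<rceil> + 1"
    unfolding a_def[symmetric] using n by linarith
qed

text \<open>Young's inequality by completing the square. It absorbs a first-order linearization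
  error into a proximal quadratic, with \<open>r\<close> equal to \<open>lam\<close> at a cycle
  start and to \<open>lam / \<tau>\<close> later.\<close>

lemma quadratic_min_le:
  fixes b d r :: real
  assumes "r > 0"
  shows "b * d \<le> d\<^sup>2 / (2 * r) + r * b\<^sup>2 / 2"
proof -
  have "0 \<le> (d - r * b)\<^sup>2 / (2 * r)"
    using assms by simp
  also have "\<dots> = d\<^sup>2 / (2 * r) + r * b\<^sup>2 / 2 - b * d"
    using assms by (simp add: power2_eq_square field_simps)
  finally show ?thesis
    by simp
qed

text \<open>\<open>M\<close> and \<open>Dh\<close> enter only as upper bounds, for the root second
  moment of the oracle and for distances in the domain. The cycle ends \<open>e\<close> take no
  sample point as argument: they are deterministic.\<close>

locale scpb_setting = prob_space P for P :: "'w measure" +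
  fixes f h :: "'a::euclidean_space \<Rightarrow> ereal"
    and s :: "'a \<Rightarrow> 'e::topological_space \<Rightarrow> 'a"
    and D :: "'e measure"
    and \<xi> :: "nat \<Rightarrow> 'w \<Rightarrow> 'e"
    and lam \<theta> R M Dh :: real
    and K :: nat
    and x0 :: 'a
    and e :: "nat \<Rightarrow> nat"
    and S x y :: "nat \<Rightarrow> 'w \<Rightarrow> 'a"
  assumes f: "proper_closed_convex f" and h: "proper_closed_convex h"
    and dom: "eff_dom h \<subseteq> eff_dom f"
    and s_measurable: "(\<lambda>(z, w). s z w) \<in> borel_measurable (restrict_space borel (eff_dom h) \<Otimes>\<^sub>M borel)"
    and s_integrable: "\<And>z. z \<in> eff_dom h \<Longrightarrow> integrable D (s z)"
    and s_subgradient: "\<And>z. z \<in> eff_dom h \<Longrightarrow> (\<integral>w. s z w \<partial>D) \<in> subdifferential f z"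
    and s_square_integrable: "\<And>z. z \<in> eff_dom h \<Longrightarrow> integrable D (\<lambda>w. (norm (s z w))\<^sup>2)"
    and s_square_le: "\<And>z. z \<in> eff_dom h \<Longrightarrow> (\<integral>w. (norm (s z w))\<^sup>2 \<partial>D) \<le> M\<^sup>2"
    and M: "M \<ge> 0"
    and diam: "\<And>a b. a \<in> eff_dom h \<Longrightarrow> b \<in> eff_dom h \<Longrightarrow> norm (a - b) \<le> Dh"
    and indep: "indep_vars (\<lambda>_. borel) \<xi> UNIV"
    and law: "\<And>i. distr P borel (\<xi> i) = D"
    and lam: "lam > 0" and \<theta>: "\<theta> > 0" and K: "K \<ge> 1" and R: "R > 0"
    and x0: "x0 \<in> eff_dom h"
    and run: "\<And>\<omega>. \<omega> \<in> space P \<Longrightarrow>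
      scpb1_run h s lam \<theta> K R x0 e (\<lambda>i. \<xi> i \<omega>) (\<lambda>j. S j \<omega>) (\<lambda>j. x j \<omega>) (\<lambda>j. y j \<omega>)"
begin

section \<open>Real-valued objective and oracle estimates\<close>

abbreviation "X \<equiv> eff_dom h"
abbreviation "\<tau> \<equiv> scpb_tau \<theta> K"

text \<open>Faithful where \<open>f\<close> is finite; elsewhere \<open>real_of_ereal\<close>
  returns 0. The estimates for \<open>G\<close>, \<open>H\<close> and \<open>\<Phi>\<close>
  therefore carry membership in \<open>X\<close>.\<close>

definition "G u = real_of_ereal (f u)"
definition "H u = real_of_ereal (h u)"
definition "\<Phi> u = G u + H u"

lemmas tau = scpb_tau_bounds[OF \<theta> K]

lemma \<xi>_measurable [measurable]: "\<xi> i \<in> borel_measurable P"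
  using indep by (auto simp: indep_vars_def)

lemma prob_space_D: "prob_space D"
  using prob_space_distr[OF \<xi>_measurable] law by metis

lemma ereal_\<Phi>:
  assumes "u \<in> X"
  shows "f u + h u = ereal (\<Phi> u)"
proof -
  have "f u = ereal (G u)" "h u = ereal (H u)"
    using assms dom ereal_real_of_eff_dom[OF f, of u] ereal_real_of_eff_dom[OF h, of u]
    by (auto simp: G_def H_def)
  then show ?thesis
    by (simp add: \<Phi>_def)
qed

lemma convex_X: "convex X"
  using proper_closed_convex_convex_on[OF h] by (simp add: convex_on_def)

lemma convex_on_\<Phi>: "convex_on X \<Phi>"
proof -
  have "convex_on X G" "convex_on X H"
    using proper_closed_convex_convex_on[OF f] proper_closed_convex_convex_on[OF h]
    by (auto simp: G_def[abs_def] H_def[abs_def] convex_X intro: convex_on_subset[OF _ dom])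
  then show ?thesis
    unfolding \<Phi>_def[abs_def] by (rule convex_on_add)
qed

lemma G_measurable [measurable]: "G \<in> borel_measurable borel"
  unfolding G_def[abs_def] using proper_closed_convex_borel_measurable[OF f] by measurable

lemma H_measurable [measurable]: "H \<in> borel_measurable borel"
  unfolding H_def[abs_def] using proper_closed_convex_borel_measurable[OF h] by measurable

lemma s_norm_integral_le:
  assumes z: "z \<in> X"
  shows "(\<integral>w. norm (s z w) \<partial>D) \<le> M"
proof -
  interpret D: prob_space D by (rule prob_space_D)
  have "(\<integral>w. norm (s z w) \<partial>D)\<^sup>2 \<le> (\<integral>w. (norm (s z w))\<^sup>2 \<partial>D)"
    using s_integrable[OF z] s_square_integrable[OF z] by (intro D.expectation_square_le) auto
  also have "\<dots> \<le> M\<^sup>2"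
    by (rule s_square_le[OF z])
  finally show ?thesis
    using M by (rule power2_le_imp_le)
qed

lemma G_subgradient:
  assumes z: "z \<in> X" and u: "u \<in> X"
  shows "G z + (\<integral>w. s z w \<partial>D) \<bullet> (u - z) \<le> G u"
proof -
  have "f z + ereal ((\<integral>w. s z w \<partial>D) \<bullet> (u - z)) \<le> f u"
    using s_subgradient[OF z] by (auto simp: subdifferential_def)
  moreover have "f z = ereal (G z)" "f u = ereal (G u)"
    using dom z u by (auto simp: G_def ereal_real_of_eff_dom[OF f])
  ultimately show ?thesis
    by simp
qed

text \<open>The mean of the oracle at \<open>z\<close> is a subgradient of norm at most
  \<open>M\<close>, which makes \<open>G\<close> Lipschitz on \<open>X\<close> with constant
  \<open>M\<close>.\<close>

lemma G_diff_le:
  assumes z: "z \<in> X" and u: "u \<in> X"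
  shows "G z - G u \<le> M * norm (z - u)"
proof -
  have "norm (\<integral>w. s z w \<partial>D) \<le> M"
    using integral_norm_bound[of D "s z"] s_norm_integral_le[OF z] by linarith
  then have "norm (\<integral>w. s z w \<partial>D) * norm (z - u) \<le> M * norm (z - u)"
    by (rule mult_right_mono) simp
  then have "(\<integral>w. s z w \<partial>D) \<bullet> (z - u) \<le> M * norm (z - u)"
    using norm_cauchy_schwarz[of "\<integral>w. s z w \<partial>D" "z - u"] by linarith
  moreover have "(\<integral>w. s z w \<partial>D) \<bullet> (z - u) = - ((\<integral>w. s z w \<partial>D) \<bullet> (u - z))"
    by (simp add: inner_diff_right)
  ultimately show ?thesis
    using G_subgradient[OF z u] by linarith
qed

text \<open>Without smoothness the error is of first order: \<open>M\<close> comes from the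
  Lipschitz bound for \<open>G\<close>, and the norm of the arbitrary slope from
  Cauchy-Schwarz.\<close>

lemma linearization_gap:
  assumes z: "z \<in> X" and z': "z' \<in> X"
  shows "G z' - (G z + \<sigma> \<bullet> (z' - z)) \<le> (M + norm \<sigma>) * norm (z' - z)"
proof -
  have "- (\<sigma> \<bullet> (z' - z)) \<le> norm \<sigma> * norm (z' - z)"
    using Cauchy_Schwarz_ineq2[of \<sigma> "z' - z"] by linarith
  then show ?thesis
    using G_diff_le[OF z' z] by (simp add: distrib_right)
qed

text \<open>Since \<open>Z\<close> depends only on samples before \<open>\<xi> j\<close>, it can be
  frozen while \<open>\<xi> j\<close> is integrated with law \<open>D\<close>. The mean slope is
  then a subgradient, so the linearization lies below \<open>G u\<close> in expectation. Subtracting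
  \<open>G u\<close> leaves an increment of \<open>G\<close>, which is bounded on
  \<open>X\<close>.\<close>

lemma
  assumes Z: "Z \<in> borel_measurable (past P \<xi> j)" and ZX: "\<forall>\<omega>\<in>space P. Z \<omega> \<in> X"
  shows oracle_past: "(\<lambda>\<omega>. s (Z \<omega>) (\<xi> j \<omega>)) \<in> borel_measurable (past P \<xi> (Suc j))"
    and oracle_square_integrable: "integrable P (\<lambda>\<omega>. (norm (s (Z \<omega>) (\<xi> j \<omega>)))\<^sup>2)"
    and oracle_square_le: "expectation (\<lambda>\<omega>. (norm (s (Z \<omega>) (\<xi> j \<omega>)))\<^sup>2) \<le> M\<^sup>2"
    and linearization_integrable:
      "u \<in> X \<Longrightarrow> integrable P (\<lambda>\<omega>. G (Z \<omega>) + s (Z \<omega>) (\<xi> j \<omega>) \<bullet> (u - Z \<omega>) - G u)"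
    and linearization_le:
      "u \<in> X \<Longrightarrow> expectation (\<lambda>\<omega>. G (Z \<omega>) + s (Z \<omega>) (\<xi> j \<omega>) \<bullet> (u - Z \<omega>) - G u) \<le> 0"
proof -
  let ?N = "restrict_space borel X :: 'a measure"
  interpret D: prob_space D by (rule prob_space_D)
  have spN [simp]: "space ?N = X"
    by (simp add: space_restrict_space)
  have ZN: "Z \<in> past P \<xi> j \<rightarrow>\<^sub>M ?N"
    using Z ZX by (intro measurable_restrict_space2) auto
  have ZP: "Z \<in> P \<rightarrow>\<^sub>M ?N"
    by (rule measurable_past_measurable[OF \<xi>_measurable ZN])
  have "(\<lambda>\<omega>. (Z \<omega>, \<xi> j \<omega>)) \<in> past P \<xi> (Suc j) \<rightarrow>\<^sub>M ?N \<Otimes>\<^sub>M borel"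
    by (intro measurable_Pair measurable_past_mono[OF _ ZN] measurable_past_component) auto
  from measurable_compose[OF this s_measurable]
  show "(\<lambda>\<omega>. s (Z \<omega>) (\<xi> j \<omega>)) \<in> borel_measurable (past P \<xi> (Suc j))"
    by simp
  have s': "(\<lambda>p. s (fst p) (snd p)) \<in> borel_measurable (?N \<Otimes>\<^sub>M borel)"
    using s_measurable by (simp add: case_prod_beta')
  note rule = integral_product_law_le[OF ZP \<xi>_measurable distr_past_pair[OF indep ZN],
      unfolded law space_restrict_space spN]
  let ?g = "\<lambda>p. (norm (s (fst p) (snd p)))\<^sup>2"
  have g: "?g \<in> borel_measurable (?N \<Otimes>\<^sub>M borel)"
    using s' by measurable
  show "integrable P (\<lambda>\<omega>. (norm (s (Z \<omega>) (\<xi> j \<omega>)))\<^sup>2)"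
    "expectation (\<lambda>\<omega>. (norm (s (Z \<omega>) (\<xi> j \<omega>)))\<^sup>2) \<le> M\<^sup>2"
    using rule[OF g, of "M\<^sup>2" "M\<^sup>2"] s_square_integrable s_square_le by auto
  assume u: "u \<in> X"
  let ?l = "\<lambda>p. G (fst p) + s (fst p) (snd p) \<bullet> (u - fst p) - G u"
  have id: "(\<lambda>z. z) \<in> ?N \<rightarrow>\<^sub>M borel"
    by (rule measurable_restrict_space1) simp
  have fst': "fst \<in> ?N \<Otimes>\<^sub>M borel \<rightarrow>\<^sub>M (borel :: 'a measure)"
    by (rule measurable_compose[OF measurable_fst id])
  have l: "?l \<in> borel_measurable (?N \<Otimes>\<^sub>M borel)"
    using s' fst' by measurable
  have int: "integrable D (\<lambda>w. G z + s z w \<bullet> (u - z) - G u)" if "z \<in> X" for z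
    using s_integrable[OF that] by simp
  have le: "(\<integral>w. G z + s z w \<bullet> (u - z) - G u \<partial>D) \<le> 0" if z: "z \<in> X" for z
    using G_subgradient[OF z u] s_integrable[OF z] by (simp add: D.prob_space)
  \<comment> \<open>One \<open>M * Dh\<close> bounds the increment of \<open>G\<close>, the other
    the inner product with the sampled slope, whose norm has mean at most \<open>M\<close>.\<close>
  have bound: "(\<integral>w. \<bar>G z + s z w \<bullet> (u - z) - G u\<bar> \<partial>D) \<le> 2 * M * Dh" if z: "z \<in> X" for z
  proof -
    have d: "norm (u - z) \<le> Dh"
      by (rule diam[OF u z])
    have "\<bar>G z + s z w \<bullet> (u - z) - G u\<bar> \<le> M * Dh + norm (s z w) * Dh" for w
    proof -
      have "\<bar>G z - G u\<bar> \<le> M * norm (u - z)"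
        using G_diff_le[OF z u] G_diff_le[OF u z] by (simp add: norm_minus_commute abs_le_iff)
      also have "\<dots> \<le> M * Dh"
        by (rule mult_left_mono[OF d M])
      finally have "\<bar>G z - G u\<bar> \<le> M * Dh" .
      moreover have "\<bar>s z w \<bullet> (u - z)\<bar> \<le> norm (s z w) * Dh"
        using Cauchy_Schwarz_ineq2[of "s z w" "u - z"] mult_left_mono[OF d, of "norm (s z w)"] by simp
      ultimately show ?thesis
        by linarith
    qed
    then have "(\<integral>w. \<bar>G z + s z w \<bullet> (u - z) - G u\<bar> \<partial>D) \<le> (\<integral>w. M * Dh + norm (s z w) * Dh \<partial>D)"
      using s_integrable[OF z] int[OF z] by (intro integral_mono) auto
    also have "\<dots> = M * Dh + (\<integral>w. norm (s z w) \<partial>D) * Dh"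
      using s_integrable[OF z] by (simp add: D.prob_space)
    also have "\<dots> \<le> M * Dh + M * Dh"
      using s_norm_integral_le[OF z] d norm_ge_zero[of "u - z"]
      by (intro add_left_mono mult_right_mono) linarith+
    finally show ?thesis
      by linarith
  qed
  show "integrable P (\<lambda>\<omega>. G (Z \<omega>) + s (Z \<omega>) (\<xi> j \<omega>) \<bullet> (u - Z \<omega>) - G u)"
    "expectation (\<lambda>\<omega>. G (Z \<omega>) + s (Z \<omega>) (\<xi> j \<omega>) \<bullet> (u - Z \<omega>) - G u) \<le> 0"
    using rule[OF l, of "2 * M * Dh" 0] int bound le by auto
qed

section \<open>Cycle indices and the recursion of a run\<close>

lemma cycle_end_less:
  assumes "k \<in> {1..K}"
  shows "e (k - 1) < e k"
proof -
  \<comment> \<open>A single sample point suffices, because \<open>e\<close> is the same for all of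
    them.\<close>
  obtain \<omega> where "\<omega> \<in> space P"
    using not_empty by auto
  from run[OF this] assms show ?thesis
    by (force simp: scpb1_run_def scpb_run_def cycle_ends_def cycle_start_def)
qed

lemma cycle_end_0: "e 0 = 0"
proof -
  obtain \<omega> where "\<omega> \<in> space P"
    using not_empty by auto
  from run[OF this] show ?thesis
    by (simp add: scpb1_run_def scpb_run_def cycle_ends_def)
qed

lemma cycle_rule: "scpb1_rule lam \<theta> K R e"
proof -
  obtain \<omega> where "\<omega> \<in> space P"
    using not_empty by auto
  from run[OF this] show ?thesis
    by (simp add: scpb1_run_def)
qed

lemma cycle_end_mono:
  assumes "k \<le> l" "l \<le> K"
  shows "e k \<le> e l"
  using assms
proof (induction l)
  case (Suc l)
  then show ?case
    using cycle_end_less[of "Suc l"] by (cases "k = Suc l") auto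
qed simp

lemma obtain_cycle:
  assumes "0 < j" "j \<le> e K"
  obtains k where "k \<in> {1..K}" "e (k - 1) < j" "j \<le> e k"
proof -
  define k where "k = (LEAST k. j \<le> e k)"
  have k: "j \<le> e k" "k \<le> K"
    using assms LeastI[of "\<lambda>k. j \<le> e k" K] Least_le[of "\<lambda>k. j \<le> e k" K] by (auto simp: k_def)
  then have "k \<noteq> 0"
    using assms cycle_end_0 by (intro notI) simp
  then have "\<not> j \<le> e (k - 1)"
    using not_less_Least[of "k - 1" "\<lambda>k. j \<le> e k"] by (simp add: k_def)
  then show ?thesis
    using k \<open>k \<noteq> 0\<close> by (intro that[of k]) auto
qed

lemma
  assumes \<omega>: "\<omega> \<in> space P" and k: "k \<in> {1..K}"
  shows run_S_start: "S (Suc (e (k - 1))) \<omega> = s (x (e (k - 1)) \<omega>) (\<xi> (e (k - 1)) \<omega>)"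
    and run_y_start: "y (Suc (e (k - 1))) \<omega> = x (Suc (e (k - 1))) \<omega>"
    and run_S_step: "e (k - 1) < j \<Longrightarrow> j < e k \<Longrightarrow>
      S (Suc j) \<omega> = (1 - \<tau>) *\<^sub>R s (x j \<omega>) (\<xi> j \<omega>) + \<tau> *\<^sub>R S j \<omega>"
    and run_y_step: "e (k - 1) < j \<Longrightarrow> j < e k \<Longrightarrow>
      y (Suc j) \<omega> = (1 - \<tau>) *\<^sub>R x (Suc j) \<omega> + \<tau> *\<^sub>R y j \<omega>"
    and run_prox: "e (k - 1) < j \<Longrightarrow> j \<le> e k \<Longrightarrow>
      prox_step h lam (S j \<omega>) (x (e (k - 1)) \<omega>) (x j \<omega>)"
proof -
  have *: "\<forall>j\<in>cycle e k.
        S j \<omega> = (if j = cycle_start e k then s (x (e (k - 1)) \<omega>) (\<xi> (e (k - 1)) \<omega>)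
               else (1 - \<tau>) *\<^sub>R s (x (j - 1) \<omega>) (\<xi> (j - 1) \<omega>) + \<tau> *\<^sub>R S (j - 1) \<omega>) \<and>
        prox_step h lam (S j \<omega>) (x (e (k - 1)) \<omega>) (x j \<omega>) \<and>
        y j \<omega> = (if j = cycle_start e k then x j \<omega>
               else (1 - \<tau>) *\<^sub>R x j \<omega> + \<tau> *\<^sub>R y (j - 1) \<omega>)"
    using run[OF \<omega>] k unfolding scpb1_run_def scpb_run_def Let_def prox_step_def by blast
  show "S (Suc (e (k - 1))) \<omega> = s (x (e (k - 1)) \<omega>) (\<xi> (e (k - 1)) \<omega>)"
    "y (Suc (e (k - 1))) \<omega> = x (Suc (e (k - 1))) \<omega>"
    using bspec[OF *, of "Suc (e (k - 1))"] cycle_end_less[OF k]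
    by (auto simp: cycle_def cycle_start_def)
  show "S (Suc j) \<omega> = (1 - \<tau>) *\<^sub>R s (x j \<omega>) (\<xi> j \<omega>) + \<tau> *\<^sub>R S j \<omega>"
    "y (Suc j) \<omega> = (1 - \<tau>) *\<^sub>R x (Suc j) \<omega> + \<tau> *\<^sub>R y j \<omega>" if "e (k - 1) < j" "j < e k"
    using bspec[OF *, of "Suc j"] that by (auto simp: cycle_def cycle_start_def)
  show "prox_step h lam (S j \<omega>) (x (e (k - 1)) \<omega>) (x j \<omega>)" if "e (k - 1) < j" "j \<le> e k"
    using bspec[OF *, of j] that by (auto simp: cycle_def cycle_start_def)
qed

lemma x_0: "\<omega> \<in> space P \<Longrightarrow> x 0 \<omega> = x0"
  using run by (auto simp: scpb1_run_def scpb_run_def)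

section \<open>Feasibility, adaptedness and moments of the iterates\<close>

lemma x_in_X:
  assumes "\<omega> \<in> space P" "j \<le> e K"
  shows "x j \<omega> \<in> X"
proof (cases "j = 0")
  case True
  then show ?thesis
    using assms x_0 x0 by simp
next
  case False
  then obtain k where "k \<in> {1..K}" "e (k - 1) < j" "j \<le> e k"
    using assms by (auto elim: obtain_cycle)
  then show ?thesis
    using prox_step_eff_dom[OF h run_prox] assms by blast
qed

lemma y_in_X:
  assumes \<omega>: "\<omega> \<in> space P" and j: "0 < j" "j \<le> e K"
  shows "y j \<omega> \<in> X"
  using j
proof (induction j)
  case (Suc j)
  from Suc.prems obtain k where k: "k \<in> {1..K}" "e (k - 1) < Suc j" "Suc j \<le> e k"
    by (rule obtain_cycle)
  show ?case
  proof (cases "j = e (k - 1)")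
    case True
    then show ?thesis
      using run_y_start[OF \<omega> k(1)] x_in_X[OF \<omega> Suc.prems(2)] by simp
  next
    case False
    then have "y (Suc j) \<omega> = (1 - \<tau>) *\<^sub>R x (Suc j) \<omega> + \<tau> *\<^sub>R y j \<omega>" "0 < j"
      using k run_y_step[OF \<omega> k(1), of j] by auto
    then show ?thesis
      using convexD[OF convex_X x_in_X[OF \<omega> Suc.prems(2)] Suc.IH] tau(1,2) Suc.prems by simp
  qed
qed simp

text \<open>Iterate \<open>j\<close> uses samples of index below \<open>j\<close> only. The
  induction is strong because the prox-center may lie many steps back.\<close>

lemma adapted:
  assumes "j \<le> e K"
  shows "x j \<in> borel_measurable (past P \<xi> j) \<and> (0 < j \<longrightarrow>
    S j \<in> borel_measurable (past P \<xi> j) \<and> y j \<in> borel_measurable (past P \<xi> j))"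
  using assms
proof (induction j rule: less_induct)
  case (less j)
  show ?case
  proof (cases j)
    case 0
    have "x 0 \<in> borel_measurable (past P \<xi> 0) \<longleftrightarrow> (\<lambda>_. x0) \<in> borel_measurable (past P \<xi> 0)"
      by (rule measurable_cong) (simp add: x_0)
    then show ?thesis
      using 0 by simp
  next
    case (Suc i)
    then have "0 < j"
      by simp
    then obtain k where k: "k \<in> {1..K}" "e (k - 1) < j" "j \<le> e k"
      using less.prems by (rule obtain_cycle)
    have past: "Z \<in> borel_measurable (past P \<xi> l) \<Longrightarrow> l \<le> j \<Longrightarrow> Z \<in> borel_measurable (past P \<xi> j)"
      for Z :: "'w \<Rightarrow> 'a" and l
      using measurable_past_mono by blast
    have grad: "(\<lambda>\<omega>. s (x i \<omega>) (\<xi> i \<omega>)) \<in> borel_measurable (past P \<xi> j)"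
      unfolding Suc using less.IH[of i] less.prems Suc x_in_X by (intro oracle_past) auto
    have Sj: "S j \<in> borel_measurable (past P \<xi> j)"
    proof (cases "i = e (k - 1)")
      case True
      have "S j \<in> borel_measurable (past P \<xi> j)
          \<longleftrightarrow> (\<lambda>\<omega>. s (x i \<omega>) (\<xi> i \<omega>)) \<in> borel_measurable (past P \<xi> j)"
        by (rule measurable_cong) (use k Suc True run_S_start in simp)
      then show ?thesis
        using grad by simp
    next
      case False
      then have i: "e (k - 1) < i" "i < e k"
        using k Suc by auto
      have "S j \<in> borel_measurable (past P \<xi> j)
          \<longleftrightarrow> (\<lambda>\<omega>. (1 - \<tau>) *\<^sub>R s (x i \<omega>) (\<xi> i \<omega>) + \<tau> *\<^sub>R S i \<omega>) \<in> borel_measurable (past P \<xi> j)"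
        by (rule measurable_cong) (use k Suc i run_S_step in simp)
      moreover have "S i \<in> borel_measurable (past P \<xi> j)"
        using less.IH[of i] less.prems Suc i by (intro past[of _ i]) auto
      ultimately show ?thesis
        using grad by simp
    qed
    have "x (e (k - 1)) \<in> borel_measurable (past P \<xi> j)"
      using less.IH[of "e (k - 1)"] k less.prems by (intro past[of _ "e (k - 1)"]) auto
    then have "(\<lambda>\<omega>. x (e (k - 1)) \<omega> - lam *\<^sub>R S j \<omega>) \<in> borel_measurable (past P \<xi> j)"
      using Sj by simp
    \<comment> \<open>The prox step is a nonexpansive function of center minus \<open>lam\<close>
      times slope, and this combination is already adapted.\<close>
    then have xj: "x j \<in> borel_measurable (past P \<xi> j)"
      by (rule borel_measurable_nonexpansive_image)
        (rule prox_step_nonexpansive[OF h lam run_prox[OF _ k] run_prox[OF _ k]], simp_all)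
    have "y j \<in> borel_measurable (past P \<xi> j)"
    proof (cases "i = e (k - 1)")
      case True
      have "y j \<in> borel_measurable (past P \<xi> j) \<longleftrightarrow> x j \<in> borel_measurable (past P \<xi> j)"
        by (rule measurable_cong) (use k Suc True run_y_start in simp)
      then show ?thesis
        using xj by simp
    next
      case False
      then have i: "e (k - 1) < i" "i < e k"
        using k Suc by auto
      have "y j \<in> borel_measurable (past P \<xi> j)
          \<longleftrightarrow> (\<lambda>\<omega>. (1 - \<tau>) *\<^sub>R x j \<omega> + \<tau> *\<^sub>R y i \<omega>) \<in> borel_measurable (past P \<xi> j)"
        by (rule measurable_cong) (use k Suc i run_y_step in simp)
      moreover have "y i \<in> borel_measurable (past P \<xi> j)"
        using less.IH[of i] less.prems Suc i by (intro past[of _ i]) auto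
      ultimately show ?thesis
        using xj by simp
    qed
    then show ?thesis
      using xj Sj by simp
  qed
qed

lemma y_measurable:
  assumes "0 < j" "j \<le> e K"
  shows "y j \<in> borel_measurable P"
  by (rule measurable_past_measurable[where \<xi> = \<xi> and j = j])
    (use adapted[OF assms(2)] assms(1) in auto)

text \<open>The sum of \<open>M\<close> and the oracle norm is the factor in
  \<open>linearization_gap\<close>. Expanding its square and using first moment at most
  \<open>M\<close> and second moment at most \<open>M\<^sup>2\<close> gives the constant 4.\<close>

lemma
  assumes Z: "Z \<in> borel_measurable (past P \<xi> j)" and ZX: "\<forall>\<omega>\<in>space P. Z \<omega> \<in> X"
  shows oracle_norm_integrable: "integrable P (\<lambda>\<omega>. norm (s (Z \<omega>) (\<xi> j \<omega>)))"
    and oracle_norm_le: "expectation (\<lambda>\<omega>. norm (s (Z \<omega>) (\<xi> j \<omega>))) \<le> M"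
    and oracle_shift_integrable: "integrable P (\<lambda>\<omega>. (M + norm (s (Z \<omega>) (\<xi> j \<omega>)))\<^sup>2)"
    and oracle_shift_le: "expectation (\<lambda>\<omega>. (M + norm (s (Z \<omega>) (\<xi> j \<omega>)))\<^sup>2) \<le> 4 * M\<^sup>2"
proof -
  define N where "N = (\<lambda>\<omega>. norm (s (Z \<omega>) (\<xi> j \<omega>)))"
  have [measurable]: "N \<in> borel_measurable P"
    unfolding N_def using measurable_past_measurable[OF \<xi>_measurable oracle_past[OF Z ZX]] by measurable
  have sq: "integrable P (\<lambda>\<omega>. (N \<omega>)\<^sup>2)" "expectation (\<lambda>\<omega>. (N \<omega>)\<^sup>2) \<le> M\<^sup>2"
    unfolding N_def by (rule oracle_square_integrable[OF Z ZX] oracle_square_le[OF Z ZX])+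
  have int: "integrable P N"
    by (rule square_integrable_imp_integrable[OF _ sq(1)]) measurable
  have "(expectation N)\<^sup>2 \<le> M\<^sup>2"
    using expectation_square_le[OF int sq(1)] sq(2) by linarith
  then have le: "expectation N \<le> M"
    using M by (rule power2_le_imp_le)
  have eq: "(M + N \<omega>)\<^sup>2 = M\<^sup>2 + 2 * M * N \<omega> + (N \<omega>)\<^sup>2" for \<omega>
    by (simp add: power2_sum)
  have "2 * M * expectation N \<le> 2 * M * M"
    using le M by (intro mult_left_mono) auto
  then have "expectation (\<lambda>\<omega>. (M + N \<omega>)\<^sup>2) \<le> 4 * M\<^sup>2"
    unfolding eq using int sq by (simp add: prob_space power2_eq_square)
  moreover have "integrable P (\<lambda>\<omega>. (M + N \<omega>)\<^sup>2)"
    unfolding eq using int sq by simp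
  ultimately show "integrable P (\<lambda>\<omega>. norm (s (Z \<omega>) (\<xi> j \<omega>)))"
    "expectation (\<lambda>\<omega>. norm (s (Z \<omega>) (\<xi> j \<omega>))) \<le> M"
    "integrable P (\<lambda>\<omega>. (M + norm (s (Z \<omega>) (\<xi> j \<omega>)))\<^sup>2)"
    "expectation (\<lambda>\<omega>. (M + norm (s (Z \<omega>) (\<xi> j \<omega>)))\<^sup>2) \<le> 4 * M\<^sup>2"
    using int le by (simp_all add: N_def)
qed

section \<open>Error recursion within a cycle\<close>

definition "start_error = 2 * min (lam * M\<^sup>2) (M * Dh)"
text \<open>The fixed point of the recursion for the expected gap: one iteration takes a bound
  \<open>a\<close> to \<open>\<tau> * a + (1 - \<tau>) * step_error\<close>, starting from
  \<open>start_error\<close>.\<close>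

definition "step_error = 2 * lam * M\<^sup>2 / (\<theta> * real K)"

lemma start_error_nonneg: "start_error \<ge> 0"
  using diam[OF x0 x0] lam M by (simp add: start_error_def)

lemma step_error_nonneg: "step_error \<ge> 0"
  using lam \<theta> by (simp add: step_error_def)

text \<open>
  The witness \<open>b\<close> is the constant term of the aggregated affine model of \<open>f\<close> whose slope is
  \<open>S j\<close>; the model majorizes \<open>f u\<close> only up to the noise \<open>n\<close>, which has nonpositive mean, and
  \<open>g\<close> is the gap between \<open>\<Phi> (y j)\<close> and the optimal value of the proximal model.
\<close>

lemma cycle_invariant:
  assumes k: "k \<in> {1..K}" and u: "u \<in> X" and j: "Suc (e (k - 1)) \<le> j" "j \<le> e k"
  shows "\<exists>b n g. integrable P n \<and> expectation n \<le> 0 \<and> integrable P g \<and>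
    expectation g \<le> \<tau> ^ (j - Suc (e (k - 1))) * start_error + (1 - \<tau> ^ (j - Suc (e (k - 1)))) * step_error \<and>
    (\<forall>\<omega>\<in>space P. b \<omega> + S j \<omega> \<bullet> u \<le> G u + n \<omega> \<and>
      \<Phi> (y j \<omega>) \<le> H (x j \<omega>) + S j \<omega> \<bullet> x j \<omega> + b \<omega>
        + (norm (x j \<omega> - x (e (k - 1)) \<omega>))\<^sup>2 / (2 * lam) + g \<omega>)"
  using j
proof (induction j rule: nat_induct_at_least)
  case base
  let ?i = "e (k - 1)"
  define N where "N = (\<lambda>\<omega>. M + norm (s (x ?i \<omega>) (\<xi> ?i \<omega>)))"
  define b where "b = (\<lambda>\<omega>. G (x ?i \<omega>) - s (x ?i \<omega>) (\<xi> ?i \<omega>) \<bullet> x ?i \<omega>)"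
  define n where "n = (\<lambda>\<omega>. G (x ?i \<omega>) + s (x ?i \<omega>) (\<xi> ?i \<omega>) \<bullet> (u - x ?i \<omega>) - G u)"
  \<comment> \<open>The first linearization error is \<open>N \<omega>\<close> times the step
    length. Young's inequality against the proximal term leaves the first entry; bounding the step
    by \<open>Dh\<close> gives the second. Their means yield the two entries of
    \<open>start_error\<close>.\<close>
  define g where "g = (\<lambda>\<omega>. min (lam * (N \<omega>)\<^sup>2 / 2) (N \<omega> * Dh))"
  have ik: "?i < e k" "e k \<le> e K"
    using cycle_end_less[OF k] cycle_end_mono[of k K] k by auto
  have xi: "x ?i \<in> borel_measurable (past P \<xi> ?i)" "\<forall>\<omega>\<in>space P. x ?i \<omega> \<in> X"
    using adapted[of ?i] x_in_X[of _ ?i] ik by auto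
  have n: "integrable P n" "expectation n \<le> 0"
    unfolding n_def by (rule linearization_integrable[OF xi u] linearization_le[OF xi u])+
  have N: "integrable P N" "expectation N \<le> 2 * M"
    "integrable P (\<lambda>\<omega>. (N \<omega>)\<^sup>2)" "expectation (\<lambda>\<omega>. (N \<omega>)\<^sup>2) \<le> 4 * M\<^sup>2"
    unfolding N_def using oracle_norm_integrable[OF xi] oracle_norm_le[OF xi]
      oracle_shift_integrable[OF xi] oracle_shift_le[OF xi] by (auto simp: prob_space)
  have g: "integrable P g"
    unfolding g_def using N by (intro integrable_min) auto
  have "expectation g \<le> expectation (\<lambda>\<omega>. lam * (N \<omega>)\<^sup>2 / 2)"
    using g N by (intro integral_mono) (auto simp: g_def)
  also have "\<dots> = lam * expectation (\<lambda>\<omega>. (N \<omega>)\<^sup>2) / 2"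
    by simp
  also have "\<dots> \<le> lam * (4 * M\<^sup>2) / 2"
    using N lam by (intro divide_right_mono mult_left_mono) auto
  finally have g1: "expectation g \<le> 2 * (lam * M\<^sup>2)"
    by simp
  have "expectation g \<le> expectation (\<lambda>\<omega>. N \<omega> * Dh)"
    using g N by (intro integral_mono) (auto simp: g_def)
  also have "\<dots> = expectation N * Dh"
    by simp
  also have "\<dots> \<le> 2 * M * Dh"
    using N diam[OF x0 x0] by (intro mult_right_mono) auto
  finally have "expectation g \<le> start_error"
    using g1 by (simp add: start_error_def)
  then have gE: "expectation g \<le> \<tau> ^ (Suc ?i - Suc ?i) * start_error
      + (1 - \<tau> ^ (Suc ?i - Suc ?i)) * step_error"
    by simp
  have "b \<omega> + S (Suc ?i) \<omega> \<bullet> u \<le> G u + n \<omega> \<and>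
      \<Phi> (y (Suc ?i) \<omega>) \<le> H (x (Suc ?i) \<omega>) + S (Suc ?i) \<omega> \<bullet> x (Suc ?i) \<omega> + b \<omega>
        + (norm (x (Suc ?i) \<omega> - x ?i \<omega>))\<^sup>2 / (2 * lam) + g \<omega>" if \<omega>: "\<omega> \<in> space P" for \<omega>
  proof
    let ?\<sigma> = "s (x ?i \<omega>) (\<xi> ?i \<omega>)" and ?d = "norm (x (Suc ?i) \<omega> - x ?i \<omega>)"
    have S: "S (Suc ?i) \<omega> = ?\<sigma>" and y: "y (Suc ?i) \<omega> = x (Suc ?i) \<omega>"
      by (rule run_S_start[OF \<omega> k] run_y_start[OF \<omega> k])+
    show "b \<omega> + S (Suc ?i) \<omega> \<bullet> u \<le> G u + n \<omega>"
      unfolding b_def n_def S inner_diff_right by simp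
    have X: "x (Suc ?i) \<omega> \<in> X"
      using x_in_X[OF \<omega>, of "Suc ?i"] ik by simp
    have N0: "N \<omega> \<ge> 0"
      using M by (simp add: N_def)
    have "N \<omega> * ?d \<le> N \<omega> * Dh"
      using diam[OF X bspec[OF xi(2) \<omega>]] N0 by (rule mult_left_mono)
    moreover have "0 \<le> ?d\<^sup>2 / (2 * lam)"
      using lam by simp
    moreover note quadratic_min_le[OF lam, of "N \<omega>" ?d]
    ultimately have "N \<omega> * ?d \<le> ?d\<^sup>2 / (2 * lam) + g \<omega>"
      by (simp add: g_def min_def)
    moreover have "G (x (Suc ?i) \<omega>) - (G (x ?i \<omega>) + ?\<sigma> \<bullet> (x (Suc ?i) \<omega> - x ?i \<omega>)) \<le> N \<omega> * ?d"
      unfolding N_def by (rule linearization_gap[OF bspec[OF xi(2) \<omega>] X])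
    ultimately show "\<Phi> (y (Suc ?i) \<omega>) \<le> H (x (Suc ?i) \<omega>) + S (Suc ?i) \<omega> \<bullet> x (Suc ?i) \<omega> + b \<omega>
        + ?d\<^sup>2 / (2 * lam) + g \<omega>"
      unfolding S y b_def \<Phi>_def inner_diff_right by linarith
  qed
  then show ?case
    by (intro exI[of _ b] exI[of _ n] exI[of _ g] conjI ballI n g gE) (simp_all only:)
next
  case (Suc j)
  let ?m = "j - Suc (e (k - 1))"
  from Suc.IH[OF Suc_leD[OF Suc.prems]] obtain b n g where n: "integrable P n" "expectation n \<le> 0" and g: "integrable P g"
      "expectation g \<le> \<tau> ^ ?m * start_error + (1 - \<tau> ^ ?m) * step_error"
    and inv1: "\<And>\<omega>. \<omega> \<in> space P \<Longrightarrow> b \<omega> + S j \<omega> \<bullet> u \<le> G u + n \<omega>"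
    and inv2: "\<And>\<omega>. \<omega> \<in> space P \<Longrightarrow> \<Phi> (y j \<omega>) \<le> H (x j \<omega>) + S j \<omega> \<bullet> x j \<omega> + b \<omega>
        + (norm (x j \<omega> - x (e (k - 1)) \<omega>))\<^sup>2 / (2 * lam) + g \<omega>"
    by blast
  have j: "e (k - 1) < j" "j < e k" "j \<le> e K" "Suc j \<le> e K"
    using Suc cycle_end_mono[of k K] k by auto
  define N where "N = (\<lambda>\<omega>. M + norm (s (x j \<omega>) (\<xi> j \<omega>)))"
  \<comment> \<open>The old model and the new linearization are averaged with the weights that
    define \<open>S (Suc j)\<close>, so the slope of the new model is again the aggregated
    one.\<close>
  define b' where "b' = (\<lambda>\<omega>. (1 - \<tau>) * (G (x j \<omega>) - s (x j \<omega>) (\<xi> j \<omega>) \<bullet> x j \<omega>) + \<tau> * b \<omega>)"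
  define l where "l = (\<lambda>\<omega>. G (x j \<omega>) + s (x j \<omega>) (\<xi> j \<omega>) \<bullet> (u - x j \<omega>) - G u)"
  define n' where "n' = (\<lambda>\<omega>. (1 - \<tau>) * l \<omega> + \<tau> * n \<omega>)"
  \<comment> \<open>The remainder coefficient in Young's inequality with radius
    \<open>lam / \<tau>\<close>, chosen so that its quadratic part is exactly \<open>\<tau>\<close>
    times the strong-convexity gain of the preceding prox step.\<close>
  define \<kappa> where "\<kappa> = lam / \<tau> * (1 - \<tau>)\<^sup>2 / 2"
  define g' where "g' = (\<lambda>\<omega>. \<kappa> * (N \<omega>)\<^sup>2 + \<tau> * g \<omega>)"
  have xj: "x j \<in> borel_measurable (past P \<xi> j)" "\<forall>\<omega>\<in>space P. x j \<omega> \<in> X"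
    using adapted[OF j(3)] x_in_X[OF _ j(3)] by auto
  have l: "integrable P l" "expectation l \<le> 0"
    unfolding l_def by (rule linearization_integrable[OF xj u] linearization_le[OF xj u])+
  have N: "integrable P (\<lambda>\<omega>. (N \<omega>)\<^sup>2)" "expectation (\<lambda>\<omega>. (N \<omega>)\<^sup>2) \<le> 4 * M\<^sup>2"
    unfolding N_def by (rule oracle_shift_integrable[OF xj] oracle_shift_le[OF xj])+
  have "\<kappa> \<ge> 0"
    using tau(1,2) lam by (simp add: \<kappa>_def)
  have "expectation n' = (1 - \<tau>) * expectation l + \<tau> * expectation n"
    unfolding n'_def using l n by simp
  also have "\<dots> \<le> 0"
    using l n tau(1,2) by (intro add_nonpos_nonpos mult_nonneg_nonpos) auto
  finally have n': "integrable P n'" "expectation n' \<le> 0"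
    using l n by (auto simp: n'_def)
  \<comment> \<open>One factor \<open>1 - \<tau>\<close> is kept and the other combines with the
    division by \<open>\<tau>\<close> to \<open>1 / (\<theta> * real K)\<close>, which produces
    \<open>step_error\<close>.\<close>
  have "\<kappa> * (4 * M\<^sup>2) = (1 - \<tau>) * ((1 - \<tau>) / \<tau> * (2 * lam * M\<^sup>2))"
    by (simp add: \<kappa>_def power2_eq_square)
  then have \<kappa>: "\<kappa> * (4 * M\<^sup>2) = (1 - \<tau>) * step_error"
    unfolding tau(4) step_error_def by simp
  have "expectation g' = \<kappa> * expectation (\<lambda>\<omega>. (N \<omega>)\<^sup>2) + \<tau> * expectation g"
    unfolding g'_def using N g by simp
  also have "\<dots> \<le> \<kappa> * (4 * M\<^sup>2) + \<tau> * (\<tau> ^ ?m * start_error + (1 - \<tau> ^ ?m) * step_error)"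
    using N g tau(1,2) \<open>\<kappa> \<ge> 0\<close> by (intro add_mono mult_left_mono) auto
  also have "\<dots> = \<tau> ^ Suc ?m * start_error + (1 - \<tau> ^ Suc ?m) * step_error"
    unfolding \<kappa> by (simp add: algebra_simps)
  also have "Suc ?m = Suc j - Suc (e (k - 1))"
    using j by simp
  finally have g': "integrable P g'" "expectation g' \<le> \<tau> ^ (Suc j - Suc (e (k - 1))) * start_error
      + (1 - \<tau> ^ (Suc j - Suc (e (k - 1)))) * step_error"
    using N g by (auto simp: g'_def)
  have "b' \<omega> + S (Suc j) \<omega> \<bullet> u \<le> G u + n' \<omega> \<and>
      \<Phi> (y (Suc j) \<omega>) \<le> H (x (Suc j) \<omega>) + S (Suc j) \<omega> \<bullet> x (Suc j) \<omega> + b' \<omega>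
        + (norm (x (Suc j) \<omega> - x (e (k - 1)) \<omega>))\<^sup>2 / (2 * lam) + g' \<omega>" if \<omega>: "\<omega> \<in> space P" for \<omega>
  proof
    define \<sigma> where "\<sigma> = s (x j \<omega>) (\<xi> j \<omega>)"
    define c where "c = x (e (k - 1)) \<omega>"
    define z where "z = x j \<omega>"
    define z' where "z' = x (Suc j) \<omega>"
    define q where "q = (\<lambda>a b :: 'a. (norm (a - b))\<^sup>2 / (2 * lam))"
    have S: "S (Suc j) \<omega> = (1 - \<tau>) *\<^sub>R \<sigma> + \<tau> *\<^sub>R S j \<omega>"
      unfolding \<sigma>_def by (rule run_S_step[OF \<omega> k j(1,2)])
    have "\<tau> * (b \<omega> + S j \<omega> \<bullet> u) \<le> \<tau> * (G u + n \<omega>)"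
      using inv1[OF \<omega>] tau(1,2) by (intro mult_left_mono) auto
    then show "b' \<omega> + S (Suc j) \<omega> \<bullet> u \<le> G u + n' \<omega>"
      unfolding S b'_def n'_def l_def \<sigma>_def[symmetric]
      by (simp add: inner_add_left inner_diff_right algebra_simps)
    have zX: "z \<in> X" and z'X: "z' \<in> X"
      unfolding z_def z'_def using bspec[OF xj(2) \<omega>] x_in_X[OF \<omega> j(4)] by auto
    have yX: "y j \<omega> \<in> X"
      using j by (intro y_in_X[OF \<omega>]) auto
    have y: "\<Phi> (y (Suc j) \<omega>) \<le> (1 - \<tau>) * \<Phi> z' + \<tau> * \<Phi> (y j \<omega>)"
      unfolding run_y_step[OF \<omega> k j(1,2)] z'_def[symmetric]
      using tau(1,2) by (intro convex_onD[OF convex_on_\<Phi>] z'X yX) auto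
    \<comment> \<open>The old optimal model value is compared with the old model at the new iterate;
      the gain \<open>q z' z\<close> will pay for the new linearization error.\<close>
    have "H z + S j \<omega> \<bullet> z + q z c + q z' z \<le> H z' + S j \<omega> \<bullet> z' + q z' c"
      unfolding H_def q_def using prox_step_strong[OF h lam run_prox[OF \<omega> k j(1)] z'X] j(2)
      by (simp add: z_def c_def)
    then have "\<Phi> (y j \<omega>) \<le> H z' + S j \<omega> \<bullet> z' + q z' c - q z' z + b \<omega> + g \<omega>"
      using inv2[OF \<omega>] unfolding z_def[symmetric] c_def[symmetric] q_def by linarith
    then have "\<tau> * \<Phi> (y j \<omega>) \<le> \<tau> * (H z' + S j \<omega> \<bullet> z' + q z' c - q z' z + b \<omega> + g \<omega>)"
      using tau(1,2) by (intro mult_left_mono) auto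
    moreover have "(1 - \<tau>) * (G z' - (G z + \<sigma> \<bullet> (z' - z))) \<le> (1 - \<tau>) * (N \<omega> * norm (z' - z))"
      using linearization_gap[OF zX z'X, of \<sigma>] tau(1,2)
      by (intro mult_left_mono) (auto simp: N_def \<sigma>_def z_def)
    moreover have "(1 - \<tau>) * (N \<omega> * norm (z' - z)) \<le> \<tau> * q z' z + \<kappa> * (N \<omega>)\<^sup>2"
    proof -
      have "((1 - \<tau>) * N \<omega>) * norm (z' - z)
          \<le> (norm (z' - z))\<^sup>2 / (2 * (lam / \<tau>)) + lam / \<tau> * ((1 - \<tau>) * N \<omega>)\<^sup>2 / 2"
        using lam tau(1,2) by (intro quadratic_min_le) auto
      then show ?thesis
        by (simp add: q_def \<kappa>_def power_mult_distrib mult_ac)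
    qed
    \<comment> \<open>The old gap contributes only \<open>\<tau>\<close> times the proximal term at
      the new iterate, whereas the new model contains it in full.\<close>
    moreover have "0 \<le> (1 - \<tau>) * q z' c"
      using tau(1,2) lam by (simp add: q_def)
    ultimately have "\<Phi> (y (Suc j) \<omega>)
        \<le> H z' + S (Suc j) \<omega> \<bullet> z' + b' \<omega> + q z' c + g' \<omega>"
      using y unfolding S b'_def g'_def \<sigma>_def[symmetric]
      unfolding z_def[symmetric] \<Phi>_def[of z']
      by (simp add: inner_add_left inner_diff_right algebra_simps)
    then show "\<Phi> (y (Suc j) \<omega>) \<le> H (x (Suc j) \<omega>) + S (Suc j) \<omega> \<bullet> x (Suc j) \<omega> + b' \<omega>
        + (norm (x (Suc j) \<omega> - x (e (k - 1)) \<omega>))\<^sup>2 / (2 * lam) + g' \<omega>"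
      by (simp add: z'_def c_def q_def)
  qed
  then show ?case
    by (intro exI[of _ b'] exI[of _ n'] exI[of _ g'] conjI ballI n' g') (simp_all only:)
qed

section \<open>From a single cycle to the averaged output\<close>

lemma cycle_bound:
  assumes k: "k \<in> {1..K}" and u: "u \<in> X"
  shows "\<exists>g. integrable P g \<and> expectation g \<le> R / (lam * real k) * start_error + step_error \<and>
    (\<forall>\<omega>\<in>space P. \<Phi> (y (e k) \<omega>) \<le> \<Phi> u
      + ((norm (u - x (e (k - 1)) \<omega>))\<^sup>2 - (norm (u - x (e k) \<omega>))\<^sup>2) / (2 * lam) + g \<omega>)"
proof -
  define t where "t = \<tau> ^ (e k - Suc (e (k - 1)))"
  have ek: "e (k - 1) < e k"
    by (rule cycle_end_less[OF k])
  then have "Suc (e (k - 1)) \<le> e k"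
    by simp
  from cycle_invariant[OF k u this order_refl]
  obtain b n g where n: "integrable P n" "expectation n \<le> 0" and g: "integrable P g"
      "expectation g \<le> t * start_error + (1 - t) * step_error"
    and inv1: "\<And>\<omega>. \<omega> \<in> space P \<Longrightarrow> b \<omega> + S (e k) \<omega> \<bullet> u \<le> G u + n \<omega>"
    and inv2: "\<And>\<omega>. \<omega> \<in> space P \<Longrightarrow> \<Phi> (y (e k) \<omega>) \<le> H (x (e k) \<omega>) + S (e k) \<omega> \<bullet> x (e k) \<omega> + b \<omega>
        + (norm (x (e k) \<omega> - x (e (k - 1)) \<omega>))\<^sup>2 / (2 * lam) + g \<omega>"
    by (auto simp: t_def)
  \<comment> \<open>The stopping rule is used here: it bounds the weight of the initial gap that
    survives at the end of the cycle.\<close>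
  have "lam * real k * t \<le> R"
    using scpb1_rule_least(1)[OF cycle_rule \<theta> K lam R k] by (simp add: t_def cycle_start_def)
  then have "t \<le> R / (lam * real k)"
    using k lam by (simp add: field_simps)
  then have "t * start_error + (1 - t) * step_error \<le> R / (lam * real k) * start_error + 1 * step_error"
    using start_error_nonneg step_error_nonneg tau(1,2)
    by (intro add_mono mult_right_mono) (auto simp: t_def)
  then have "expectation (\<lambda>\<omega>. n \<omega> + g \<omega>) \<le> R / (lam * real k) * start_error + step_error"
    using n g by simp
  \<comment> \<open>Strong convexity at the last iterate bounds the optimal model value by the model
    at \<open>u\<close> minus a squared distance; the model at \<open>u\<close> exceeds
    \<open>\<Phi> u\<close> by at most the noise and the proximal term.\<close>
  moreover have "\<Phi> (y (e k) \<omega>) \<le> \<Phi> u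
      + ((norm (u - x (e (k - 1)) \<omega>))\<^sup>2 - (norm (u - x (e k) \<omega>))\<^sup>2) / (2 * lam) + (n \<omega> + g \<omega>)"
    if \<omega>: "\<omega> \<in> space P" for \<omega>
    using inv1[OF \<omega>] inv2[OF \<omega>] prox_step_strong[OF h lam run_prox[OF \<omega> k ek order_refl] u]
    unfolding \<Phi>_def[of u] H_def diff_divide_distrib by linarith
  ultimately show ?thesis
    using n g by (intro exI[of _ "\<lambda>\<omega>. n \<omega> + g \<omega>"]) auto
qed

text \<open>Convexity passes from the output to the average over the last half of the cycles, where
  the squared distances telescope because each cycle ends at the next prox-center. All indices there
  exceed \<open>K div 2\<close>, so the surviving initial gaps are of order
  \<open>1 / K\<close>.\<close>

lemma integral_output_le:
  assumes u: "u \<in> X" and min: "\<And>v. v \<in> X \<Longrightarrow> \<Phi> u \<le> \<Phi> v"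
  defines "out \<equiv> \<lambda>\<omega>. scpb_output K e (\<lambda>j. y j \<omega>)"
  shows "\<forall>\<omega>\<in>space P. out \<omega> \<in> X" "integrable P (\<lambda>\<omega>. \<Phi> (out \<omega>))"
    "expectation (\<lambda>\<omega>. \<Phi> (out \<omega>)) \<le> \<Phi> u
      + 1 / real K * (Dh\<^sup>2 / lam + 6 * R * min (lam * M\<^sup>2) (M * Dh) / lam + 2 * lam * M\<^sup>2 / \<theta>)"
proof -
  define I where "I = {K div 2 + 1..K}"
  define c where "c = 1 / real (card I)"
  \<comment> \<open>The per-cycle bound at the smallest averaged index, where it is largest.\<close>
  define T where "T = R / (lam * real (K div 2 + 1)) * start_error + step_error"
  have I: "finite I" "I \<noteq> {}" and IK: "\<And>k. k \<in> I \<Longrightarrow> k \<in> {1..K}"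
    using K by (auto simp: I_def)
  have card: "card I > 0" "real K \<le> 2 * real (card I)"
    using I K by (auto simp: I_def)
  have "\<lceil>real K / 2\<rceil> = int (card I)"
    by (rule ceiling_unique) (use K in \<open>auto simp: I_def of_nat_diff field_simps\<close>)
  then have out: "out \<omega> = (\<Sum>k\<in>I. c *\<^sub>R y (e k) \<omega>)" for \<omega>
    by (simp add: out_def scpb_output_def I_def c_def scaleR_sum_right)
  have c: "c > 0" "(\<Sum>k\<in>I. c) = 1"
    using card(1) by (auto simp: c_def)
  have ek: "0 < e k" "e k \<le> e K" if "k \<in> I" for k
    using cycle_end_less[OF IK[OF that]] cycle_end_mono[of k K] IK[OF that] by auto
  have yX: "y (e k) \<omega> \<in> X" if "\<omega> \<in> space P" "k \<in> I" for \<omega> k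
    using that ek by (intro y_in_X) auto
  show outX: "\<forall>\<omega>\<in>space P. out \<omega> \<in> X"
    unfolding out using c yX by (intro ballI convex_sum[OF I(1) convex_X]) auto
  have "\<forall>k\<in>I. \<exists>g. integrable P g \<and> expectation g \<le> R / (lam * real k) * start_error + step_error \<and>
    (\<forall>\<omega>\<in>space P. \<Phi> (y (e k) \<omega>) \<le> \<Phi> u
      + ((norm (u - x (e (k - 1)) \<omega>))\<^sup>2 - (norm (u - x (e k) \<omega>))\<^sup>2) / (2 * lam) + g \<omega>)"
    using cycle_bound[OF IK u] by blast
  then obtain g where g: "\<And>k. k \<in> I \<Longrightarrow> integrable P (g k)"
      "\<And>k. k \<in> I \<Longrightarrow> expectation (g k) \<le> R / (lam * real k) * start_error + step_error"
    and step: "\<And>k \<omega>. k \<in> I \<Longrightarrow> \<omega> \<in> space P \<Longrightarrow> \<Phi> (y (e k) \<omega>) \<le> \<Phi> u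
      + ((norm (u - x (e (k - 1)) \<omega>))\<^sup>2 - (norm (u - x (e k) \<omega>))\<^sup>2) / (2 * lam) + g k \<omega>"
    unfolding bchoice_iff by blast
  \<comment> \<open>The telescoped distances are at most \<open>Dh\<^sup>2\<close>; only the cycle
    errors remain random, so this pathwise bound is integrable.\<close>
  define W where "W = (\<lambda>\<omega>. \<Phi> u + c * (Dh\<^sup>2 / (2 * lam)) + (\<Sum>k\<in>I. c * g k \<omega>))"
  have upper: "\<Phi> (out \<omega>) \<le> W \<omega>" if \<omega>: "\<omega> \<in> space P" for \<omega>
  proof -
    define d where "d = (\<lambda>k. (norm (u - x (e k) \<omega>))\<^sup>2)"
    have "\<Phi> (out \<omega>) \<le> (\<Sum>k\<in>I. c * \<Phi> (y (e k) \<omega>))"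
      unfolding out using c I yX[OF \<omega>] by (intro convex_on_sum[OF _ _ convex_on_\<Phi>]) auto
    also have "\<dots> \<le> (\<Sum>k\<in>I. c * (\<Phi> u + (d (k - 1) - d k) / (2 * lam) + g k \<omega>))"
      using step[OF _ \<omega>] c by (intro sum_mono mult_left_mono) (auto simp: d_def)
    also have "\<dots> = (\<Sum>k\<in>I. c) * \<Phi> u + c / (2 * lam) * (\<Sum>k\<in>I. d (k - 1) - d k) + (\<Sum>k\<in>I. c * g k \<omega>)"
      by (simp add: distrib_left sum.distrib sum_distrib_left sum_distrib_right)
    also have "(\<Sum>k\<in>I. d (k - 1) - d k) = d (K div 2) - d K"
      using sum_telescope''[of "K div 2" K "\<lambda>k. - d k"] by (simp add: I_def)
    also have "(\<Sum>k\<in>I. c) * \<Phi> u + c / (2 * lam) * (d (K div 2) - d K) + (\<Sum>k\<in>I. c * g k \<omega>)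
        \<le> 1 * \<Phi> u + c / (2 * lam) * Dh\<^sup>2 + (\<Sum>k\<in>I. c * g k \<omega>)"
    proof -
      have "norm (u - x (e (K div 2)) \<omega>) \<le> Dh"
        using cycle_end_mono[of "K div 2" K] by (intro diam u x_in_X[OF \<omega>]) auto
      then have "d (K div 2) \<le> Dh\<^sup>2"
        unfolding d_def by (intro power_mono) auto
      moreover have "d K \<ge> 0"
        by (simp add: d_def)
      ultimately have "d (K div 2) - d K \<le> Dh\<^sup>2"
        by linarith
      then show ?thesis
        unfolding c(2) using c(1) lam by (intro add_mono mult_left_mono) auto
    qed
    finally show ?thesis
      by (simp add: W_def)
  qed
  have W: "integrable P W"
    unfolding W_def using g(1) by auto
  have [measurable]: "out \<in> borel_measurable P"
    unfolding out using ek y_measurable by (intro borel_measurable_sum borel_measurable_scaleR) auto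
  have [measurable]: "\<Phi> \<in> borel_measurable borel"
    unfolding \<Phi>_def[abs_def] by measurable
  show int: "integrable P (\<lambda>\<omega>. \<Phi> (out \<omega>))"
  proof (rule Bochner_Integration.integrable_bound)
    show "integrable P (\<lambda>\<omega>. \<bar>\<Phi> u\<bar> + \<bar>W \<omega>\<bar>)"
      using W by simp
    show "AE \<omega> in P. norm (\<Phi> (out \<omega>)) \<le> norm (\<bar>\<Phi> u\<bar> + \<bar>W \<omega>\<bar>)"
    proof (rule AE_I2)
      fix \<omega> assume \<omega>: "\<omega> \<in> space P"
      show "norm (\<Phi> (out \<omega>)) \<le> norm (\<bar>\<Phi> u\<bar> + \<bar>W \<omega>\<bar>)"
        using upper[OF \<omega>] min[OF bspec[OF outX \<omega>]] by (simp add: abs_if)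
    qed
  qed measurable
  have "expectation (g k) \<le> T" if "k \<in> I" for k
  proof -
    have "R / (lam * real k) * start_error \<le> R / (lam * real (K div 2 + 1)) * start_error"
      using lam R start_error_nonneg that
      by (intro mult_right_mono divide_left_mono mult_left_mono) (auto simp: I_def)
    then show ?thesis
      using g(2)[OF that] by (simp add: T_def)
  qed
  then have gT: "(\<Sum>k\<in>I. c * expectation (g k)) \<le> (\<Sum>k\<in>I. c * T)"
    using c by (intro sum_mono mult_left_mono) auto
  have "expectation (\<lambda>\<omega>. \<Phi> (out \<omega>)) \<le> expectation W"
    using int W upper by (rule integral_mono)
  also have "\<dots> = \<Phi> u + c * (Dh\<^sup>2 / (2 * lam)) + (\<Sum>k\<in>I. c * expectation (g k))"
    unfolding W_def using g(1) by (simp add: prob_space)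
  also have "\<dots> \<le> \<Phi> u + c * (Dh\<^sup>2 / (2 * lam)) + T"
    using gT unfolding sum_distrib_right[symmetric] c(2) by simp
  \<comment> \<open>At least half of the \<open>K\<close> cycles are averaged, hence
    \<open>c \<le> 2 / real K\<close>.\<close>
  also have "c * (Dh\<^sup>2 / (2 * lam)) \<le> 2 / real K * (Dh\<^sup>2 / (2 * lam))"
    using card K lam by (intro mult_right_mono) (auto simp: c_def divide_simps)
  also have "T \<le> 1 / real K * (6 * R * min (lam * M\<^sup>2) (M * Dh) / lam) + step_error"
  proof -
    \<comment> \<open>The estimate \<open>K / 3 \<le> K div 2 + 1\<close> is loose: the factor 3
      together with the 2 in \<open>start_error\<close> makes the constant 6.\<close>
    have "R / (lam * real (K div 2 + 1)) \<le> R / (lam * (real K / 3))"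
      using lam R K by (intro divide_left_mono mult_left_mono) auto
    then have "R / (lam * real (K div 2 + 1)) * start_error \<le> R / (lam * (real K / 3)) * start_error"
      using start_error_nonneg by (rule mult_right_mono)
    then show ?thesis
      by (simp add: T_def start_error_def mult_ac)
  qed
  finally show "expectation (\<lambda>\<omega>. \<Phi> (out \<omega>)) \<le> \<Phi> u
      + 1 / real K * (Dh\<^sup>2 / lam + 6 * R * min (lam * M\<^sup>2) (M * Dh) / lam + 2 * lam * M\<^sup>2 / \<theta>)"
    by (simp add: step_error_def distrib_left mult_ac)
qed

end

section \<open>Transfer to the extended-real problem\<close>

theorem theorem3p1:
  fixes f h \<phi> :: "real ^ 'n \<Rightarrow> ereal"
    and F :: "real ^ 'n \<Rightarrow> real ^ 'd \<Rightarrow> real"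
    and s :: "real ^ 'n \<Rightarrow> real ^ 'd \<Rightarrow> real ^ 'n"
    and D :: "(real ^ 'd) measure"
    and P :: "'w measure"
    and \<xi> :: "nat \<Rightarrow> 'w \<Rightarrow> real ^ 'd"
    and lam \<theta> R Mbar Dh :: real
    and K :: nat
    and x0 :: "real ^ 'n"
    and e :: "nat \<Rightarrow> nat"
    and S x y :: "nat \<Rightarrow> 'w \<Rightarrow> real ^ 'n"
  defines "\<phi> \<equiv> (\<lambda>u. f u + h u)"
    and "Mbar \<equiv> second_moment_bound D (eff_dom h) s"
    and "Dh \<equiv> diameter (eff_dom h)"
  assumes D: "prob_space D" "sets D = sets borel"
    and A1: "proper_closed_convex f" "proper_closed_convex h" "eff_dom h \<subseteq> eff_dom f"
    and A2: "functional_oracle D (eff_dom h) f F" "subgradient_oracle D (eff_dom h) f s"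
    and A3: "finite_second_moment D (eff_dom h) s"
    and A4: "optimal_solutions \<phi> \<noteq> {}"
    and bounded_dom: "bounded (eff_dom h)"
    and samples: "prob_space P" "prob_space.indep_vars P (\<lambda>_. borel) \<xi> UNIV"
      "\<And>i. distr P borel (\<xi> i) = D"
    and input: "lam > 0" "\<theta> > 0" "K \<ge> 1" "R > 0" "x0 \<in> eff_dom h"
    and SCPB1: "\<And>\<omega>. \<omega> \<in> space P \<Longrightarrow>
      scpb1_run h s lam \<theta> K R x0 e (\<lambda>i. \<xi> i \<omega>) (\<lambda>j. S j \<omega>) (\<lambda>j. x j \<omega>) (\<lambda>j. y j \<omega>)"
  shows "(\<forall>k\<in>{1..K}. int (card (cycle e k))
            \<le> \<lceil>(\<theta> * real K + 1) * ln_0_plus (lam * real k / R)\<rceil> + 1) \<and>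
         (AE \<omega> in P. \<bar>\<phi> (scpb_output K e (\<lambda>j. y j \<omega>))\<bar> \<noteq> \<infinity>) \<and>
         integrable P (\<lambda>\<omega>. real_of_ereal (\<phi> (scpb_output K e (\<lambda>j. y j \<omega>)))) \<and>
         ereal (\<integral>\<omega>. real_of_ereal (\<phi> (scpb_output K e (\<lambda>j. y j \<omega>))) \<partial>P) - optimal_value \<phi>
           \<le> ereal (1 / real K * (Dh\<^sup>2 / lam + 6 * R * min (lam * Mbar\<^sup>2) (Mbar * Dh) / lam
                + 2 * lam * Mbar\<^sup>2 / \<theta>))"
proof -
  have ZD: "(\<lambda>(z, w). s z w) \<in> borel_measurable (restrict_space borel (eff_dom h) \<Otimes>\<^sub>M borel)"
    using A2(2) unfolding subgradient_oracle_def
    by (simp cong: measurable_cong_sets sets_pair_measure_cong add: D(2))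
  \<comment> \<open>The supremum dominates the nonnegative value at any point of the domain, and
    \<open>x0\<close> supplies such a point.\<close>
  have M0: "0 \<le> Mbar" and sq: "(\<integral>w. (norm (s z w))\<^sup>2 \<partial>D) \<le> Mbar\<^sup>2" if z: "z \<in> eff_dom h" for z
  proof -
    have *: "sqrt (\<integral>w. (norm (s z w))\<^sup>2 \<partial>D) \<le> Mbar"
      unfolding Mbar_def second_moment_bound_def
      using A3 z by (intro cSUP_upper) (auto simp: finite_second_moment_def)
    then show "(\<integral>w. (norm (s z w))\<^sup>2 \<partial>D) \<le> Mbar\<^sup>2"
      by (rule sqrt_le_D)
    have "0 \<le> sqrt (\<integral>w. (norm (s z w))\<^sup>2 \<partial>D)"
      by simp
    then show "0 \<le> Mbar"
      using * by linarith
  qed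
  interpret P: prob_space P by (rule samples(1))
  interpret scpb_setting P f h s D \<xi> lam \<theta> R Mbar Dh K x0 e S x y
  proof unfold_locales
    fix a b assume "a \<in> eff_dom h" "b \<in> eff_dom h"
    then show "norm (a - b) \<le> Dh"
      unfolding Dh_def using diameter_bounded_bound[OF bounded_dom] by (simp add: dist_norm)
  qed (use A1 A2 A3 ZD M0 sq samples input SCPB1 in
      \<open>auto simp: subgradient_oracle_def finite_second_moment_def\<close>)
  obtain u where u: "\<phi> u = optimal_value \<phi>"
    using A4 by (auto simp: optimal_solutions_def)
  have \<phi>: "\<phi> v = ereal (\<Phi> v)" if "v \<in> eff_dom h" for v
    unfolding \<phi>_def by (rule ereal_\<Phi>[OF that])
  have le: "\<phi> u \<le> \<phi> v" for v
    unfolding u optimal_value_def by (rule INF_lower) simp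
  \<comment> \<open>The minimal value is at most the finite value at \<open>x0\<close>, which forces
    the minimizer into the domain of \<open>h\<close>.\<close>
  have uX: "u \<in> eff_dom h"
  proof -
    have "f u + h u < \<infinity>"
      using le[of x0] \<phi>[OF input(5)] by (auto simp: \<phi>_def)
    then show ?thesis
      using A1(1) by (auto simp: eff_dom_def proper_closed_convex_def)
  qed
  have min: "\<Phi> u \<le> \<Phi> v" if "v \<in> eff_dom h" for v
    using le[of v] \<phi>[OF that] \<phi>[OF uX] by simp
  note out = integral_output_le[OF uX min]
  have eq: "\<phi> (scpb_output K e (\<lambda>j. y j \<omega>)) = ereal (\<Phi> (scpb_output K e (\<lambda>j. y j \<omega>)))"
    if "\<omega> \<in> space P" for \<omega>
    using out(1) that by (intro \<phi>) auto
  have int: "integrable P (\<lambda>\<omega>. real_of_ereal (\<phi> (scpb_output K e (\<lambda>j. y j \<omega>))))"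
    using out(2) by (simp add: eq cong: Bochner_Integration.integrable_cong)
  have E: "(\<integral>\<omega>. real_of_ereal (\<phi> (scpb_output K e (\<lambda>j. y j \<omega>))) \<partial>P)
      = (\<integral>\<omega>. \<Phi> (scpb_output K e (\<lambda>j. y j \<omega>)) \<partial>P)"
    by (rule Bochner_Integration.integral_cong) (simp_all add: eq)
  show ?thesis
  proof (intro conjI ballI)
    show "int (card (cycle e k)) \<le> \<lceil>(\<theta> * real K + 1) * ln_0_plus (lam * real k / R)\<rceil> + 1"
      if "k \<in> {1..K}" for k
      by (rule scpb1_rule_least(2)[OF cycle_rule \<theta> K lam R that])
    show "AE \<omega> in P. \<bar>\<phi> (scpb_output K e (\<lambda>j. y j \<omega>))\<bar> \<noteq> \<infinity>"
      by (rule AE_I2) (simp add: eq)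
    show "ereal (\<integral>\<omega>. real_of_ereal (\<phi> (scpb_output K e (\<lambda>j. y j \<omega>))) \<partial>P) - optimal_value \<phi>
        \<le> ereal (1 / real K * (Dh\<^sup>2 / lam + 6 * R * min (lam * Mbar\<^sup>2) (Mbar * Dh) / lam
            + 2 * lam * Mbar\<^sup>2 / \<theta>))"
      unfolding E u[symmetric] \<phi>[OF uX] using out(3) by simp
  qed (rule int)
qed

end
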